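(* There is a one-to-one correspondence between equivalence classes of skeletal $2$-term averaging $L_\infty$-algebras and triples of the form $(\mathfrak{g}_P,V_Q,[(f,\theta)])$, where $\mathfrak{g}_P$ is an averaging Lie algebra, $V_Q$ is a representation of $\mathfrak{g}_P$, and $[(f,\theta)]\in H^3_{\mathrm{ALie}}(\mathfrak{g}_P,V_Q)$ is a third cohomology class.
   Context: Everything is over a field $\mathbf{k}$ of characteristic zero. An averaging operator on a Lie algebra $\mathfrak{g}$ is a linear map $P:\mathfrak{g}\to\mathfrak{g}$ with $[P(x),P(y)]_{\mathfrak{g}}=P([P(x),y]_{\mathfrak{g}})$ for all $x,y$. An averaging Lie algebra $\mathfrak{g}_P$ is a Lie algebra $\mathfrak{g}$ with an averaging operator $P$. A representation $V_Q$ of $\mathfrak{g}_P$ is a Lie algebra representation $\psi:\mathfrak{g}\to\mathrm{End}(V)$ with a linear map $Q:V\to V$ such that $\psi_{P(x)}Q(v)=Q(\psi_{P(x)}v)=Q(\psi_xQ(v))$ for all $x\in\mathfrak{g}$, $v\in V$. Cohomology: $C^0_{\mathrm{ALie}}(\mathfrak{g}_P,V_Q)=0$, $C^1_{\mathrm{ALie}}(\mathfrak{g}_P,V_Q)=\mathrm{Hom}(\mathfrak{g},V)$, and $C^n_{\mathrm{ALie}}(\mathfrak{g}_P,V_Q)=\mathrm{Hom}(\wedge^n\mathfrak{g},V)\oplus\mathrm{Hom}(\mathfrak{g}^{\otimes n-1},V)$ for $n\ge2$, with coboundary $$\delta^n_{\mathrm{ALie}}((f,\theta))=\big(\delta^n_{\mathrm{Lie}}(f),\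 \partial^{n-1}_{\mathrm{Leib}}(\theta)+(-1)^nf\circ P^{\otimes n}-(-1)^nQf\circ(P^{\otimes n-1}\otimes\mathrm{Id})\big)$$ (for $n=1$ the $\theta$-terms are absent). Here $\delta_{\mathrm{Lie}}$ is the Chevalley-Eilenberg coboundary of $\mathfrak{g}$ with coefficients in $(V,\psi)$, and $$\partial^{n-1}_{\mathrm{Leib}}(\theta)(x_1,\dots,x_n)=\sum_{i=1}^{n-1}(-1)^{i+1}\psi_{P(x_i)}\theta(x_1,\dots,\widehat{x_i},\dots,x_n)+(-1)^{n+1}\psi_{P(x_n)}\theta(x_1,\dots,x_{n-1})+(-1)^nQ(\psi_{x_n}\theta(x_1,\dots,x_{n-1}))+\sum_{1\le i<j\le n}(-1)^i\theta(x_1,\dots,\widehat{x_i},\dots,x_{j-1},[P(x_i),x_j]_{\mathfrak{g}},\dots,x_n).$$ This is a cochain complex; $H^n_{\mathrm{ALie}}(\mathfrak{g}_P,V_Q)$ is its $n$-th cohomology. A $2$-term $L_\infty$-algebra $(\mathfrak{g}_1\xrightarrow{d}\mathfrak{g}_0,\llbracket\,,\,\rrbracket,l_3)$ consists of a $2$-term chain complex, i.e. a linear map $d:\mathfrak{g}_1\to\mathfrak{g}_0$, bilinear maps $\llbracket\,,\,\rrbracket:\mathfrak{g}_i\times\mathfrak{g}_j\to\mathfrak{g}_{i+j}$ ($0\le i,j\le1$, with $\mathfrak{g}_2=0$) and a skew-symmetric trilinear map $l_3:\mathfrak{g}_0\times\mathfrak{g}_0\times\mathfrak{g}_0\to\mathfrak{g}_1$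 such that for all $w,x,y,z\in\mathfrak{g}_0$, $h,k\in\mathfrak{g}_1$: (L1) $\llbracket x,y\rrbracket=-\llbracket y,x\rrbracket$; (L2) $\llbracket x,h\rrbracket=-\llbracket h,x\rrbracket$; (L3) $\llbracket h,k\rrbracket=0$; (L4) $d\llbracket x,h\rrbracket=\llbracket x,dh\rrbracket$; (L5) $\llbracket dh,k\rrbracket=\llbracket h,dk\rrbracket$; (L6) $d(l_3(x,y,z))=\llbracket x,\llbracket y,z\rrbracket\rrbracket+\llbracket y,\llbracket z,x\rrbracket\rrbracket+\llbracket z,\llbracket x,y\rrbracket\rrbracket$; (L7) $l_3(x,y,dh)=\llbracket x,\llbracket y,h\rrbracket\rrbracket+\llbracket y,\llbracket h,x\rrbracket\rrbracket+\llbracket h,\llbracket x,y\rrbracket\rrbracket$; (L8) $\llbracket w,l_3(x,y,z)\rrbracket-\llbracket x,l_3(w,y,z)\rrbracket+\llbracket y,l_3(w,x,z)\rrbracket-\llbracket z,l_3(w,x,y)\rrbracket=l_3(\llbracket w,x\rrbracket,y,z)-l_3(\llbracket w,y\rrbracket,x,z)+l_3(\llbracket w,z\rrbracket,x,y)+l_3(\llbracket x,y\rrbracket,w,z)-l_3(\llbracket x,z\rrbracket,w,y)+l_3(\llbracket y,z\rrbracket,w,x)$. A homotopy averaging operator on it is a triple $(P_0,P_1,P_2)$ of linear maps $P_0:\mathfrak{g}_0\to\mathfrak{g}_0$, $P_1:\mathfrak{g}_1\to\mathfrak{g}_1$ and a skew-symmetric bilinear map $P_2:\mathfrak{g}_0\times\mathfrak{g}_0\to\mathfrak{g}_1$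 such that for all $x,y,z\in\mathfrak{g}_0$, $h\in\mathfrak{g}_1$: (A1) $P_0\circ d=d\circ P_1$; (A2) $d(P_2(x,y))=P_0(\llbracket P_0(x),y\rrbracket)-\llbracket P_0(x),P_0(y)\rrbracket$; (A3) $P_2(x,dh)=P_1(\llbracket P_0(x),h\rrbracket)-\llbracket P_0(x),P_1(h)\rrbracket=P_1(\llbracket x,P_1(h)\rrbracket)-\llbracket P_0(x),P_1(h)\rrbracket$; (A4) $\llbracket P_0(x),P_2(y,z)\rrbracket-\llbracket P_0(y),P_2(x,z)\rrbracket+\llbracket P_0(z),P_2(x,y)\rrbracket-P_1\llbracket z,P_2(x,y)\rrbracket-P_2(\llbracket P_0(x),y\rrbracket,z)-P_2(y,\llbracket P_0(x),z\rrbracket)+P_2(x,\llbracket P_0(y),z\rrbracket)=l_3(P_0(x),P_0(y),P_0(z))-P_1l_3(P_0(x),P_0(y),z)$. A $2$-term averaging $L_\infty$-algebra is a $2$-term $L_\infty$-algebra with a homotopy averaging operator, written $(\mathfrak{g}_1\xrightarrow{d}\mathfrak{g}_0,\llbracket\,,\,\rrbracket,l_3,P_0,P_1,P_2)$. It is skeletal if $d=0$. For a skeletal one, $(\mathfrak{g}_0)_{P_0}$ is an averaging Lie algebra with bracket $\llbracket\,,\,\rrbracket|_{\mathfrak{g}_0\times\mathfrak{g}_0}$, and $(\mathfrak{g}_1)_{P_1}$ is a representation of it with action $\psi_xh=\llbracket x,h\rrbracket$. Two skeletal $2$-term averaging $L_\infty$-algebras $(\mathfrak{g}_1\xrightarrow{0}\mathfrak{g}_0,\llbracket\,,\,\rrbracket,l_3,P_0,P_1,P_2)$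 and $(\mathfrak{g}_1\xrightarrow{0}\mathfrak{g}_0,\llbracket\,,\,\rrbracket',l_3',P_0',P_1',P_2')$ on the same chain complex are equivalent if $\llbracket\,,\,\rrbracket=\llbracket\,,\,\rrbracket'$, $P_0=P_0'$, $P_1=P_1'$ and there exist a skew-symmetric bilinear map $g:\mathfrak{g}_0\times\mathfrak{g}_0\to\mathfrak{g}_1$ and a linear map $\vartheta:\mathfrak{g}_0\to\mathfrak{g}_1$ with $(l_3',P_2')=(l_3,P_2)+\delta^2_{\mathrm{ALie}}((g,\vartheta))$, where $\delta^2_{\mathrm{ALie}}$ is the coboundary operator of the averaging Lie algebra $(\mathfrak{g}_0)_{P_0}$ with coefficients in the representation $(\mathfrak{g}_1)_{P_1}$.
   Formalization: The canonical correspondence onto all triples is proved with P_2 only bilinear; for skew-symmetric P_2 it is injective with image the classes having a representative with skew θ, and only a non-canonical bijection onto all triples exists. *)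

theory Defs
  imports Complex_Main "HOL-Library.Function_Algebras" "HOL-Library.Product_Plus"
begin

(* A vector space over a field of type 'k is a type 'a :: ab_group_add together with a scalar
   multiplication s :: 'k => 'a => 'a satisfying the library locale vector_space; linear maps are
   those of Vector_Spaces.linear. *)

section \<open>Multilinear maps\<close>

definition bilinear_map ::
  "('k::field \<Rightarrow> 'a::ab_group_add \<Rightarrow> 'a) \<Rightarrow> ('k \<Rightarrow> 'b::ab_group_add \<Rightarrow> 'b) \<Rightarrow>
   ('k \<Rightarrow> 'c::ab_group_add \<Rightarrow> 'c) \<Rightarrow> ('a \<Rightarrow> 'b \<Rightarrow> 'c) \<Rightarrow> bool" where
  "bilinear_map s t u b \<longleftrightarrow>
     (\<forall>x. Vector_Spaces.linear t u (\<lambda>y. b x y)) \<and> (\<forall>y. Vector_Spaces.linear s u (\<lambda>x. b x y))"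

definition trilinear_map ::
  "('k::field \<Rightarrow> 'a::ab_group_add \<Rightarrow> 'a) \<Rightarrow> ('k \<Rightarrow> 'b::ab_group_add \<Rightarrow> 'b) \<Rightarrow>
   ('a \<Rightarrow> 'a \<Rightarrow> 'a \<Rightarrow> 'b) \<Rightarrow> bool" where
  "trilinear_map s u l \<longleftrightarrow>
     (\<forall>y z. Vector_Spaces.linear s u (\<lambda>x. l x y z)) \<and>
     (\<forall>x z. Vector_Spaces.linear s u (\<lambda>y. l x y z)) \<and>
     (\<forall>x y. Vector_Spaces.linear s u (\<lambda>z. l x y z))"

definition skew2 :: "('a \<Rightarrow> 'a \<Rightarrow> 'b::ab_group_add) \<Rightarrow> bool" where
  "skew2 b \<longleftrightarrow> (\<forall>x y. b x y = - b y x)"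

definition skew3 :: "('a \<Rightarrow> 'a \<Rightarrow> 'a \<Rightarrow> 'b::ab_group_add) \<Rightarrow> bool" where
  "skew3 l \<longleftrightarrow> (\<forall>x y z. l x y z = - l y x z \<and> l x y z = - l x z y)"

(* An element of Hom(V^{(x) n}, W) is an n-ary map, represented as a function on lists that is
   linear in each entry of a list of length n and (so that equality of functions is equality of
   n-ary maps) vanishes on lists of any other length. *)

definition multilinear ::
  "('k::field \<Rightarrow> 'a::ab_group_add \<Rightarrow> 'a) \<Rightarrow> ('k \<Rightarrow> 'b::ab_group_add \<Rightarrow> 'b) \<Rightarrow> nat \<Rightarrow>
   ('a list \<Rightarrow> 'b) set" where
  "multilinear s u n =
     {f. (\<forall>xs. length xs \<noteq> n \<longrightarrow> f xs = 0) \<and>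
         (\<forall>xs i. length xs = n \<longrightarrow> i < n \<longrightarrow> Vector_Spaces.linear s u (\<lambda>x. f (xs[i := x])))}"

definition alternating ::
  "('k::field \<Rightarrow> 'a::ab_group_add \<Rightarrow> 'a) \<Rightarrow> ('k \<Rightarrow> 'b::ab_group_add \<Rightarrow> 'b) \<Rightarrow> nat \<Rightarrow>
   ('a list \<Rightarrow> 'b) set" where
  "alternating s u n = {f \<in> multilinear s u n. \<forall>xs. \<not> distinct xs \<longrightarrow> f xs = 0}"

fun mmap1 :: "('a \<Rightarrow> 'b::zero) \<Rightarrow> 'a list \<Rightarrow> 'b" where
  "mmap1 f [x] = f x"
| "mmap1 f _ = 0"

fun mmap2 :: "('a \<Rightarrow> 'a \<Rightarrow> 'b::zero) \<Rightarrow> 'a list \<Rightarrow> 'b" where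
  "mmap2 f [x, y] = f x y"
| "mmap2 f _ = 0"

fun mmap3 :: "('a \<Rightarrow> 'a \<Rightarrow> 'a \<Rightarrow> 'b::zero) \<Rightarrow> 'a list \<Rightarrow> 'b" where
  "mmap3 f [x, y, z] = f x y z"
| "mmap3 f _ = 0"

section \<open>Averaging Lie algebras and their representations\<close>

definition lie_algebra ::
  "('k::field \<Rightarrow> 'a::ab_group_add \<Rightarrow> 'a) \<Rightarrow> ('a \<Rightarrow> 'a \<Rightarrow> 'a) \<Rightarrow> bool" where
  "lie_algebra s br \<longleftrightarrow> bilinear_map s s s br \<and> (\<forall>x. br x x = 0) \<and>
     (\<forall>x y z. br x (br y z) + br y (br z x) + br z (br x y) = 0)"

definition averaging_lie_algebra ::
  "('k::field \<Rightarrow> 'a::ab_group_add \<Rightarrow> 'a) \<Rightarrow> ('a \<Rightarrow> 'a \<Rightarrow> 'a) \<Rightarrow> ('a \<Rightarrow> 'a) \<Rightarrow> bool" where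
  "averaging_lie_algebra s br P \<longleftrightarrow> lie_algebra s br \<and> Vector_Spaces.linear s s P \<and>
     (\<forall>x y. br (P x) (P y) = P (br (P x) y))"

definition lie_representation ::
  "('k::field \<Rightarrow> 'a::ab_group_add \<Rightarrow> 'a) \<Rightarrow> ('k \<Rightarrow> 'b::ab_group_add \<Rightarrow> 'b) \<Rightarrow>
   ('a \<Rightarrow> 'a \<Rightarrow> 'a) \<Rightarrow> ('a \<Rightarrow> 'b \<Rightarrow> 'b) \<Rightarrow> bool" where
  "lie_representation s u br \<psi> \<longleftrightarrow> bilinear_map s u u \<psi> \<and>
     (\<forall>x y v. \<psi> (br x y) v = \<psi> x (\<psi> y v) - \<psi> y (\<psi> x v))"

definition averaging_representation ::
  "('k::field \<Rightarrow> 'a::ab_group_add \<Rightarrow> 'a) \<Rightarrow> ('k \<Rightarrow> 'b::ab_group_add \<Rightarrow> 'b) \<Rightarrow>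
   ('a \<Rightarrow> 'a \<Rightarrow> 'a) \<Rightarrow> ('a \<Rightarrow> 'a) \<Rightarrow> ('a \<Rightarrow> 'b \<Rightarrow> 'b) \<Rightarrow> ('b \<Rightarrow> 'b) \<Rightarrow> bool" where
  "averaging_representation s u br P \<psi> Q \<longleftrightarrow>
     lie_representation s u br \<psi> \<and> Vector_Spaces.linear u u Q \<and>
     (\<forall>x v. \<psi> (P x) (Q v) = Q (\<psi> (P x) v) \<and> Q (\<psi> (P x) v) = Q (\<psi> x (Q v)))"

section \<open>Cohomology of averaging Lie algebras\<close>

definition omit :: "nat \<Rightarrow> 'a list \<Rightarrow> 'a list" where
  "omit i xs = take i xs @ drop (Suc i) xs"

(* In the coboundary formulas the arguments x_1, ..., x_n are xs ! 0, ..., xs ! (n - 1), so each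
   1-based index in the usual formulas is one more than the index used here; the signs are adjusted
   accordingly. *)

definition lie_coboundary ::
  "('k::field \<Rightarrow> 'b::ab_group_add \<Rightarrow> 'b) \<Rightarrow> ('a \<Rightarrow> 'a \<Rightarrow> 'a) \<Rightarrow> ('a \<Rightarrow> 'b \<Rightarrow> 'b) \<Rightarrow> nat \<Rightarrow>
   ('a list \<Rightarrow> 'b) \<Rightarrow> 'a list \<Rightarrow> 'b" where
  "lie_coboundary u br \<psi> n f xs =
     (if length xs = n + 1 then
        (\<Sum>i<n + 1. u ((-1) ^ i) (\<psi> (xs ! i) (f (omit i xs)))) +
        (\<Sum>(i, j) \<in> {(i, j). i < j \<and> j < n + 1}.
           u ((-1) ^ (i + j)) (f (br (xs ! i) (xs ! j) # omit i (omit j xs))))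
      else 0)"

(* leib_coboundary ... n is the map called \partial^{n-1}_{Leib}, from (n-1)-ary to n-ary maps. *)

definition leib_coboundary ::
  "('k::field \<Rightarrow> 'b::ab_group_add \<Rightarrow> 'b) \<Rightarrow> ('a \<Rightarrow> 'a \<Rightarrow> 'a) \<Rightarrow> ('a \<Rightarrow> 'a) \<Rightarrow> ('a \<Rightarrow> 'b \<Rightarrow> 'b) \<Rightarrow>
   ('b \<Rightarrow> 'b) \<Rightarrow> nat \<Rightarrow> ('a list \<Rightarrow> 'b) \<Rightarrow> 'a list \<Rightarrow> 'b" where
  "leib_coboundary u br P \<psi> Q n \<theta> xs =
     (if length xs = n then
        (\<Sum>i<n - 1. u ((-1) ^ i) (\<psi> (P (xs ! i)) (\<theta> (omit i xs)))) +
        u ((-1) ^ (n + 1)) (\<psi> (P (last xs)) (\<theta> (butlast xs))) +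
        u ((-1) ^ n) (Q (\<psi> (last xs) (\<theta> (butlast xs)))) +
        (\<Sum>(i, j) \<in> {(i, j). i < j \<and> j < n}.
           u ((-1) ^ (i + 1)) (\<theta> (omit i (xs[j := br (P (xs ! i)) (xs ! j)]))))
      else 0)"

(* All C^n are subspaces of the pairs (f, \<theta>): C^0 = 0, and \<theta> = 0 in C^1. The \<theta>-terms of the
   coboundary then vanish for n = 1. *)

definition alie_cochains ::
  "('k::field \<Rightarrow> 'a::ab_group_add \<Rightarrow> 'a) \<Rightarrow> ('k \<Rightarrow> 'b::ab_group_add \<Rightarrow> 'b) \<Rightarrow> nat \<Rightarrow>
   (('a list \<Rightarrow> 'b) \<times> ('a list \<Rightarrow> 'b)) set" where
  "alie_cochains s u n =
     (if n = 0 then {0} else alternating s u n) \<times> (if n \<le> 1 then {0} else multilinear s u (n - 1))"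

definition alie_coboundary ::
  "('k::field \<Rightarrow> 'b::ab_group_add \<Rightarrow> 'b) \<Rightarrow> ('a \<Rightarrow> 'a \<Rightarrow> 'a) \<Rightarrow> ('a \<Rightarrow> 'a) \<Rightarrow> ('a \<Rightarrow> 'b \<Rightarrow> 'b) \<Rightarrow>
   ('b \<Rightarrow> 'b) \<Rightarrow> nat \<Rightarrow> ('a list \<Rightarrow> 'b) \<times> ('a list \<Rightarrow> 'b) \<Rightarrow>
   ('a list \<Rightarrow> 'b) \<times> ('a list \<Rightarrow> 'b)" where
  "alie_coboundary u br P \<psi> Q n = (\<lambda>(f, \<theta>).
     (lie_coboundary u br \<psi> n f,
      \<lambda>xs. leib_coboundary u br P \<psi> Q n \<theta> xs +
        (if length xs = n then
           u ((-1) ^ n) (f (map P xs)) - u ((-1) ^ n) (Q (f (map P (butlast xs) @ [last xs])))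
         else 0)))"

definition alie_cocycles ::
  "('k::field \<Rightarrow> 'a::ab_group_add \<Rightarrow> 'a) \<Rightarrow> ('k \<Rightarrow> 'b::ab_group_add \<Rightarrow> 'b) \<Rightarrow>
   ('a \<Rightarrow> 'a \<Rightarrow> 'a) \<Rightarrow> ('a \<Rightarrow> 'a) \<Rightarrow> ('a \<Rightarrow> 'b \<Rightarrow> 'b) \<Rightarrow> ('b \<Rightarrow> 'b) \<Rightarrow> nat \<Rightarrow>
   (('a list \<Rightarrow> 'b) \<times> ('a list \<Rightarrow> 'b)) set" where
  "alie_cocycles s u br P \<psi> Q n =
     {c \<in> alie_cochains s u n. alie_coboundary u br P \<psi> Q n c = 0}"

(* For n = 0 the truncated subtraction gives the image of C^0 = 0, i.e. no nonzero coboundaries. *)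

definition alie_coboundaries ::
  "('k::field \<Rightarrow> 'a::ab_group_add \<Rightarrow> 'a) \<Rightarrow> ('k \<Rightarrow> 'b::ab_group_add \<Rightarrow> 'b) \<Rightarrow>
   ('a \<Rightarrow> 'a \<Rightarrow> 'a) \<Rightarrow> ('a \<Rightarrow> 'a) \<Rightarrow> ('a \<Rightarrow> 'b \<Rightarrow> 'b) \<Rightarrow> ('b \<Rightarrow> 'b) \<Rightarrow> nat \<Rightarrow>
   (('a list \<Rightarrow> 'b) \<times> ('a list \<Rightarrow> 'b)) set" where
  "alie_coboundaries s u br P \<psi> Q n =
     alie_coboundary u br P \<psi> Q (n - 1) ` alie_cochains s u (n - 1)"

definition alie_cohomologous ::
  "('k::field \<Rightarrow> 'a::ab_group_add \<Rightarrow> 'a) \<Rightarrow> ('k \<Rightarrow> 'b::ab_group_add \<Rightarrow> 'b) \<Rightarrow>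
   ('a \<Rightarrow> 'a \<Rightarrow> 'a) \<Rightarrow> ('a \<Rightarrow> 'a) \<Rightarrow> ('a \<Rightarrow> 'b \<Rightarrow> 'b) \<Rightarrow> ('b \<Rightarrow> 'b) \<Rightarrow> nat \<Rightarrow>
   (('a list \<Rightarrow> 'b) \<times> ('a list \<Rightarrow> 'b)) rel" where
  "alie_cohomologous s u br P \<psi> Q n =
     {(c, c'). c \<in> alie_cocycles s u br P \<psi> Q n \<and> c' \<in> alie_cocycles s u br P \<psi> Q n \<and>
               c' - c \<in> alie_coboundaries s u br P \<psi> Q n}"

definition alie_cohomology ::
  "('k::field \<Rightarrow> 'a::ab_group_add \<Rightarrow> 'a) \<Rightarrow> ('k \<Rightarrow> 'b::ab_group_add \<Rightarrow> 'b) \<Rightarrow>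
   ('a \<Rightarrow> 'a \<Rightarrow> 'a) \<Rightarrow> ('a \<Rightarrow> 'a) \<Rightarrow> ('a \<Rightarrow> 'b \<Rightarrow> 'b) \<Rightarrow> ('b \<Rightarrow> 'b) \<Rightarrow> nat \<Rightarrow>
   (('a list \<Rightarrow> 'b) \<times> ('a list \<Rightarrow> 'b)) set set" where
  "alie_cohomology s u br P \<psi> Q n =
     alie_cocycles s u br P \<psi> Q n // alie_cohomologous s u br P \<psi> Q n"

type_synonym ('a, 'b) alie_triple =
  "(('a \<Rightarrow> 'a \<Rightarrow> 'a) \<times> ('a \<Rightarrow> 'a)) \<times> (('a \<Rightarrow> 'b \<Rightarrow> 'b) \<times> ('b \<Rightarrow> 'b)) \<times>
   (('a list \<Rightarrow> 'b) \<times> ('a list \<Rightarrow> 'b)) set"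

definition alie_triples ::
  "('k::field \<Rightarrow> 'a::ab_group_add \<Rightarrow> 'a) \<Rightarrow> ('k \<Rightarrow> 'b::ab_group_add \<Rightarrow> 'b) \<Rightarrow>
   ('a, 'b) alie_triple set" where
  "alie_triples s u =
     {((br, P), (\<psi>, Q), c) | br P \<psi> Q c.
        averaging_lie_algebra s br P \<and> averaging_representation s u br P \<psi> Q \<and>
        c \<in> alie_cohomology s u br P \<psi> Q 3}"

section \<open>2-term averaging L-infinity algebras\<close>

(* brij is the bracket on g_i x g_j. The bracket on g_1 x g_1 takes values in g_2 = 0; it is not
   recorded, and (L3) holds automatically. *)

record ('a, 'b) linf_data =
  diff :: "'b \<Rightarrow> 'a"
  br00 :: "'a \<Rightarrow> 'a \<Rightarrow> 'a"
  br01 :: "'a \<Rightarrow> 'b \<Rightarrow> 'b"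
  br10 :: "'b \<Rightarrow> 'a \<Rightarrow> 'b"
  tern :: "'a \<Rightarrow> 'a \<Rightarrow> 'a \<Rightarrow> 'b"
  avg0 :: "'a \<Rightarrow> 'a"
  avg1 :: "'b \<Rightarrow> 'b"
  avg2 :: "'a \<Rightarrow> 'a \<Rightarrow> 'b"

definition two_term_linf ::
  "('k::field \<Rightarrow> 'a::ab_group_add \<Rightarrow> 'a) \<Rightarrow> ('k \<Rightarrow> 'b::ab_group_add \<Rightarrow> 'b) \<Rightarrow>
   ('a, 'b) linf_data \<Rightarrow> bool" where
  "two_term_linf s u A \<longleftrightarrow>
     (let d = diff A; b = br00 A; b01 = br01 A; b10 = br10 A; l = tern A in
       Vector_Spaces.linear u s d \<and> bilinear_map s s s b \<and> bilinear_map s u u b01 \<and>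
       bilinear_map u s u b10 \<and> trilinear_map s u l \<and> skew3 l \<and>
       (\<forall>x y. b x y = - b y x) \<and>
       (\<forall>x h. b01 x h = - b10 h x) \<and>
       (\<forall>x h. d (b01 x h) = b x (d h)) \<and>
       (\<forall>h k. b01 (d h) k = b10 h (d k)) \<and>
       (\<forall>x y z. d (l x y z) = b x (b y z) + b y (b z x) + b z (b x y)) \<and>
       (\<forall>x y h. l x y (d h) = b01 x (b01 y h) + b01 y (b10 h x) + b10 h (b x y)) \<and>
       (\<forall>w x y z. b01 w (l x y z) - b01 x (l w y z) + b01 y (l w x z) - b01 z (l w x y) =
          l (b w x) y z - l (b w y) x z + l (b w z) x y + l (b x y) w z - l (b x z) w y
          + l (b y z) w x))"

definition bilinear_homotopy_averaging ::
  "('k::field \<Rightarrow> 'a::ab_group_add \<Rightarrow> 'a) \<Rightarrow> ('k \<Rightarrow> 'b::ab_group_add \<Rightarrow> 'b) \<Rightarrow>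
   ('a, 'b) linf_data \<Rightarrow> bool" where
  "bilinear_homotopy_averaging s u A \<longleftrightarrow>
     (let d = diff A; b = br00 A; b01 = br01 A; l = tern A; P0 = avg0 A; P1 = avg1 A; P2 = avg2 A in
       Vector_Spaces.linear s s P0 \<and> Vector_Spaces.linear u u P1 \<and> bilinear_map s s u P2 \<and>
       P0 \<circ> d = d \<circ> P1 \<and>
       (\<forall>x y. d (P2 x y) = P0 (b (P0 x) y) - b (P0 x) (P0 y)) \<and>
       (\<forall>x h. P2 x (d h) = P1 (b01 (P0 x) h) - b01 (P0 x) (P1 h)) \<and>
       (\<forall>x h. P2 x (d h) = P1 (b01 x (P1 h)) - b01 (P0 x) (P1 h)) \<and>
       (\<forall>x y z. b01 (P0 x) (P2 y z) - b01 (P0 y) (P2 x z) + b01 (P0 z) (P2 x y)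
          - P1 (b01 z (P2 x y)) - P2 (b (P0 x) y) z - P2 y (b (P0 x) z) + P2 x (b (P0 y) z) =
          l (P0 x) (P0 y) (P0 z) - P1 (l (P0 x) (P0 y) z)))"

(* A homotopy averaging operator is defined with a skew-symmetric P_2, whereas the component \<theta> of
   a 3-cochain (f, \<theta>) is an arbitrary bilinear map. The predicate above omits the skew-symmetry,
   the next one includes it. The distinction matters: with skew-symmetry the assignment sending the
   class of A to the class of (l_3, P_2) is injective but not onto. For example, if g_0 and g_1 are
   one-dimensional and both brackets, P_0 and P_1 are zero, then the only skew-symmetric P_2 is 0,
   while H^3 is Hom(g_0 (x) g_0, g_1), which is nonzero. *)

definition homotopy_averaging ::
  "('k::field \<Rightarrow> 'a::ab_group_add \<Rightarrow> 'a) \<Rightarrow> ('k \<Rightarrow> 'b::ab_group_add \<Rightarrow> 'b) \<Rightarrow>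
   ('a, 'b) linf_data \<Rightarrow> bool" where
  "homotopy_averaging s u A \<longleftrightarrow> bilinear_homotopy_averaging s u A \<and> skew2 (avg2 A)"

definition skeletal_averaging_linf ::
  "('k::field \<Rightarrow> 'a::ab_group_add \<Rightarrow> 'a) \<Rightarrow> ('k \<Rightarrow> 'b::ab_group_add \<Rightarrow> 'b) \<Rightarrow>
   ('a, 'b) linf_data set" where
  "skeletal_averaging_linf s u =
     {A. two_term_linf s u A \<and> homotopy_averaging s u A \<and> diff A = (\<lambda>_. 0)}"

definition skeletal_bilinear_averaging_linf ::
  "('k::field \<Rightarrow> 'a::ab_group_add \<Rightarrow> 'a) \<Rightarrow> ('k \<Rightarrow> 'b::ab_group_add \<Rightarrow> 'b) \<Rightarrow>
   ('a, 'b) linf_data set" where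
  "skeletal_bilinear_averaging_linf s u =
     {A. two_term_linf s u A \<and> bilinear_homotopy_averaging s u A \<and> diff A = (\<lambda>_. 0)}"

definition linf_cochain ::
  "('a, 'b::zero) linf_data \<Rightarrow> ('a list \<Rightarrow> 'b) \<times> ('a list \<Rightarrow> 'b)" where
  "linf_cochain A = (mmap3 (tern A), mmap2 (avg2 A))"

definition skeletal_equiv ::
  "('k::field \<Rightarrow> 'a::ab_group_add \<Rightarrow> 'a) \<Rightarrow> ('k \<Rightarrow> 'b::ab_group_add \<Rightarrow> 'b) \<Rightarrow>
   ('a, 'b) linf_data set \<Rightarrow> ('a, 'b) linf_data rel" where
  "skeletal_equiv s u S =
     {(A, A'). A \<in> S \<and> A' \<in> S \<and>
        br00 A = br00 A' \<and> br01 A = br01 A' \<and> br10 A = br10 A' \<and>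
        avg0 A = avg0 A' \<and> avg1 A = avg1 A' \<and>
        (\<exists>g t. bilinear_map s s u g \<and> skew2 g \<and> Vector_Spaces.linear s u t \<and>
           linf_cochain A' = linf_cochain A +
             alie_coboundary u (br00 A) (avg0 A) (br01 A) (avg1 A) 2 (mmap2 g, mmap1 t))}"

definition linf_triple ::
  "('k::field \<Rightarrow> 'a::ab_group_add \<Rightarrow> 'a) \<Rightarrow> ('k \<Rightarrow> 'b::ab_group_add \<Rightarrow> 'b) \<Rightarrow>
   ('a, 'b) linf_data \<Rightarrow> ('a, 'b) alie_triple" where
  "linf_triple s u A =
     ((br00 A, avg0 A), (br01 A, avg1 A),
      alie_cohomologous s u (br00 A) (avg0 A) (br01 A) (avg1 A) 3 `` {linf_cochain A})"

end

theory Submission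
  imports Defs "HOL-Library.Equipollence"
begin

text \<open>
  When \<open>d = 0\<close>, the axioms of a 2-term averaging \<open>L\<^sub>\<infinity>\<close>-algebra split into two groups. Apart
  from (L8) and (A4), the maps \<open>l\<^sub>3\<close> and \<open>P\<^sub>2\<close> occur in them only composed with \<open>d\<close> and drop out,
  and what is left says exactly that \<open>\<gg>\<^sub>0\<close> is an averaging Lie algebra and \<open>\<gg>\<^sub>1\<close> a
  representation of it; (L8) and (A4) say exactly that
  \<open>(l\<^sub>3, P\<^sub>2)\<close> is a 3-cocycle (\<open>skeletal_bilinear_averaging_linf_iff\<close>). Two structures are
  equivalent iff they share the first group of data and their cocycles differ by a coboundary,
  that is, iff \<open>linf_triple\<close> takes the same value on them (\<open>skeletal_equiv_eq_kernel\<close>). So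
  \<open>linf_triple\<close> induces a bijection from classes onto its image. The image is the set of all
  triples if \<open>P\<^sub>2\<close> is an arbitrary bilinear map (\<open>linf_triple_image\<close>), and the set of triples whose
  class has a representative with skew-symmetric second component if \<open>P\<^sub>2\<close> is skew-symmetric
  (\<open>linf_triple_image_skew\<close>).

  That the second image is nevertheless in bijection with the set of all triples is a statement
  about cardinalities, and it follows from the Schroeder-Bernstein theorem once all triples are
  injected into those with a skew-symmetric representative (\<open>alie_triples_lepoll_skew\<close>). Let \<open>W\<close> be
  the one of the two vector spaces \<open>\<gg>\<^sub>0\<close>, \<open>\<gg>\<^sub>1\<close> that has the larger dimension, and let \<open>B\<close> be a basis
  of \<open>W\<close>. A triple is determined by six multilinear maps in at most three arguments (bracket,
  action, two operators, and the two components of a representing cocycle), hence by their values on basis vectors, hence by a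
  function \<open>6 \<times> B \<times> B \<times> B \<rightarrow> W\<close>. The ground field is infinite, so \<open>W\<close> is infinite or zero, and there
  are no more such functions than functions \<open>B \<rightarrow> W\<close>: if \<open>B\<close> is infinite, then
  \<open>B\<close> absorbs the product, and if \<open>B\<close> is finite, then a finite power of \<open>W\<close> is no larger than
  \<open>W\<close>. Functions \<open>B \<rightarrow> W\<close> are endomorphisms of \<open>W\<close>, and each endomorphism is the operator of
  a triple with zero brackets and zero cohomology class.
\<close>

section \<open>Multilinear maps\<close>

lemma eq_uminus_imp_zero:
  fixes s :: "'k::field_char_0 \<Rightarrow> 'a::ab_group_add \<Rightarrow> 'a" and x :: 'a
  assumes "vector_space s" and "x = - x"
  shows "x = 0"
proof -
  interpret vector_space s by fact
  have "s 2 x = s 1 x + s 1 x"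
    by (metis one_add_one scale_left_distrib)
  also have "\<dots> = 0"
    using assms(2) by (metis scale_one add.right_inverse)
  finally show ?thesis by simp
qed

lemma all_length_1: "(\<forall>xs. length xs = Suc 0 \<longrightarrow> R xs) \<longleftrightarrow> (\<forall>x. R [x])"
  by (auto simp: length_Suc_conv)

lemma all_length_2: "(\<forall>xs. length xs = 2 \<longrightarrow> R xs) \<longleftrightarrow> (\<forall>x y. R [x, y])"
  by (auto simp: length_Suc_conv numeral_2_eq_2)

lemma all_length_3: "(\<forall>xs. length xs = 3 \<longrightarrow> R xs) \<longleftrightarrow> (\<forall>x y z. R [x, y, z])"
  by (auto simp: length_Suc_conv numeral_3_eq_3)

lemma all_length_4: "(\<forall>xs. length xs = 4 \<longrightarrow> R xs) \<longleftrightarrow> (\<forall>w x y z. R [w, x, y, z])"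
  by (auto simp: length_Suc_conv eval_nat_numeral)

lemma mmap1_eq_0: "length xs \<noteq> Suc 0 \<Longrightarrow> mmap1 f xs = 0"
  by (cases "(f, xs)" rule: mmap1.cases) auto

lemma mmap2_eq_0: "length xs \<noteq> 2 \<Longrightarrow> mmap2 f xs = 0"
  by (cases "(f, xs)" rule: mmap2.cases) auto

lemma mmap3_eq_0: "length xs \<noteq> 3 \<Longrightarrow> mmap3 f xs = 0"
  by (cases "(f, xs)" rule: mmap3.cases) auto

lemma mmap1_mem_multilinear: "mmap1 f \<in> multilinear s u 1 \<longleftrightarrow> Vector_Spaces.linear s u f"
proof -
  have "(\<forall>xs i. length xs = 1 \<longrightarrow> i < 1 \<longrightarrow> Vector_Spaces.linear s u (\<lambda>x. mmap1 f (xs[i := x]))) \<longleftrightarrow>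
      (\<forall>xs. length xs = Suc 0 \<longrightarrow> Vector_Spaces.linear s u (\<lambda>x. mmap1 f (xs[0 := x])))"
    by auto
  then show ?thesis
    unfolding multilinear_def all_length_1 by (simp add: mmap1_eq_0)
qed

lemma mmap2_mem_multilinear: "mmap2 f \<in> multilinear s u 2 \<longleftrightarrow> bilinear_map s s u f"
proof -
  have "(\<forall>xs i. length xs = 2 \<longrightarrow> i < 2 \<longrightarrow> Vector_Spaces.linear s u (\<lambda>x. mmap2 f (xs[i := x]))) \<longleftrightarrow>
      (\<forall>xs. length xs = 2 \<longrightarrow> Vector_Spaces.linear s u (\<lambda>x. mmap2 f (xs[0 := x])) \<and>
        Vector_Spaces.linear s u (\<lambda>x. mmap2 f (xs[1 := x])))"
    by (auto simp: less_2_cases_iff)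
  then show ?thesis
    unfolding multilinear_def all_length_2 by (auto simp: mmap2_eq_0 bilinear_map_def)
qed

lemma mmap3_mem_multilinear: "mmap3 f \<in> multilinear s u 3 \<longleftrightarrow> trilinear_map s u f"
proof -
  have "(\<forall>xs i. length xs = 3 \<longrightarrow> i < 3 \<longrightarrow> Vector_Spaces.linear s u (\<lambda>x. mmap3 f (xs[i := x]))) \<longleftrightarrow>
      (\<forall>xs. length xs = 3 \<longrightarrow> Vector_Spaces.linear s u (\<lambda>x. mmap3 f (xs[0 := x])) \<and>
        Vector_Spaces.linear s u (\<lambda>x. mmap3 f (xs[1 := x])) \<and>
        Vector_Spaces.linear s u (\<lambda>x. mmap3 f (xs[2 := x])))"
    by (auto simp: numeral_3_eq_3 less_Suc_eq numeral_2_eq_2)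
  then show ?thesis
    unfolding multilinear_def all_length_3 by (auto simp: mmap3_eq_0 trilinear_map_def)
qed

lemma multilinear_1_eq_mmap1: "f \<in> multilinear s u 1 \<Longrightarrow> f = mmap1 (\<lambda>x. f [x])"
proof
  fix xs assume "f \<in> multilinear s u 1"
  then show "f xs = mmap1 (\<lambda>x. f [x]) xs"
    by (cases "(\<lambda>x. f [x], xs)" rule: mmap1.cases) (auto simp: multilinear_def)
qed

lemma multilinear_2_eq_mmap2: "f \<in> multilinear s u 2 \<Longrightarrow> f = mmap2 (\<lambda>x y. f [x, y])"
proof
  fix xs assume "f \<in> multilinear s u 2"
  then show "f xs = mmap2 (\<lambda>x y. f [x, y]) xs"
    by (cases "(\<lambda>x y. f [x, y], xs)" rule: mmap2.cases) (auto simp: multilinear_def)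
qed

lemma multilinear_3_eq_mmap3: "f \<in> multilinear s u 3 \<Longrightarrow> f = mmap3 (\<lambda>x y z. f [x, y, z])"
proof
  fix xs assume "f \<in> multilinear s u 3"
  then show "f xs = mmap3 (\<lambda>x y z. f [x, y, z]) xs"
    by (cases "(\<lambda>x y z. f [x, y, z], xs)" rule: mmap3.cases) (auto simp: multilinear_def)
qed

text \<open>Polarisation: expand \<open>b (x + y) (x + y)\<close>.\<close>

lemma additive_diag_zero_imp_skew:
  fixes b :: "'a::ab_group_add \<Rightarrow> 'a \<Rightarrow> 'b::ab_group_add"
  assumes "\<And>x x' y. b (x + x') y = b x y + b x' y" and "\<And>x y y'. b x (y + y') = b x y + b x y'"
    and "\<And>x. b x x = 0"
  shows "b x y = - b y x"
proof -
  have "b (x + y) (x + y) = 0" by (rule assms(3))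
  then have "b x y + b y x = 0"
    unfolding assms(1,2) by (simp add: assms(3) add.commute)
  then show ?thesis by (simp add: eq_neg_iff_add_eq_0)
qed

lemma skew2_iff_diag_zero:
  fixes s :: "'k::field_char_0 \<Rightarrow> 'a::ab_group_add \<Rightarrow> 'a" and u :: "'k \<Rightarrow> 'b::ab_group_add \<Rightarrow> 'b"
  assumes "vector_space u" and "bilinear_map s s u g"
  shows "skew2 g \<longleftrightarrow> (\<forall>x. g x x = 0)"
proof
  assume "skew2 g"
  then show "\<forall>x. g x x = 0"
    unfolding skew2_def using eq_uminus_imp_zero[OF assms(1)] by blast
next
  assume "\<forall>x. g x x = 0"
  then have "g x y = - g y x" for x y
    using assms(2) by (intro additive_diag_zero_imp_skew) (auto simp: bilinear_map_def Vector_Spaces.linear_iff)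
  then show "skew2 g" unfolding skew2_def by blast
qed

lemma mmap2_mem_alternating:
  fixes s :: "'k::field_char_0 \<Rightarrow> 'a::ab_group_add \<Rightarrow> 'a" and u :: "'k \<Rightarrow> 'b::ab_group_add \<Rightarrow> 'b"
  assumes "vector_space u"
  shows "mmap2 g \<in> alternating s u 2 \<longleftrightarrow> bilinear_map s s u g \<and> skew2 g"
proof -
  have "(\<forall>xs. \<not> distinct xs \<longrightarrow> mmap2 g xs = 0) \<longleftrightarrow> (\<forall>xs. length xs = 2 \<longrightarrow> \<not> distinct xs \<longrightarrow> mmap2 g xs = 0)"
    using mmap2_eq_0 by blast
  also have "\<dots> \<longleftrightarrow> (\<forall>x. g x x = 0)"
    unfolding all_length_2 by auto
  finally show ?thesis
    using skew2_iff_diag_zero[OF assms] by (auto simp: alternating_def mmap2_mem_multilinear)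
qed

lemma mmap3_mem_alternating:
  fixes s :: "'k::field_char_0 \<Rightarrow> 'a::ab_group_add \<Rightarrow> 'a" and u :: "'k \<Rightarrow> 'b::ab_group_add \<Rightarrow> 'b"
  assumes "vector_space u"
  shows "mmap3 l \<in> alternating s u 3 \<longleftrightarrow> trilinear_map s u l \<and> skew3 l"
proof (cases "trilinear_map s u l")
  case True
  have "(\<forall>xs. \<not> distinct xs \<longrightarrow> mmap3 l xs = 0) \<longleftrightarrow> (\<forall>xs. length xs = 3 \<longrightarrow> \<not> distinct xs \<longrightarrow> mmap3 l xs = 0)"
    using mmap3_eq_0 by blast
  also have "\<dots> \<longleftrightarrow> (\<forall>x y. l x x y = 0 \<and> l x y x = 0 \<and> l y x x = 0)"
    unfolding all_length_3 by auto
  also have "\<dots> \<longleftrightarrow> skew3 l"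
  proof
    assume *: "\<forall>x y. l x x y = 0 \<and> l x y x = 0 \<and> l y x x = 0"
    have "l x y z = - l y x z" for x y z
      by (rule additive_diag_zero_imp_skew[of "\<lambda>x y. l x y z"])
        (use * True in \<open>auto simp: trilinear_map_def Vector_Spaces.linear_iff\<close>)
    moreover have "l x y z = - l x z y" for x y z
      by (rule additive_diag_zero_imp_skew[of "\<lambda>y z. l x y z"])
        (use * True in \<open>auto simp: trilinear_map_def Vector_Spaces.linear_iff\<close>)
    ultimately show "skew3 l" unfolding skew3_def by blast
  next
    assume "skew3 l"
    then have sk: "l x y z = - l y x z" "l x y z = - l x z y" for x y z
      unfolding skew3_def by blast+
    have "l x x y = 0" "l y x x = 0" for x y
      using sk eq_uminus_imp_zero[OF assms] by blast+
    moreover from this have "l x y x = 0" for x y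
      using sk(2)[of x y x] by simp
    ultimately show "\<forall>x y. l x x y = 0 \<and> l x y x = 0 \<and> l y x x = 0" by blast
  qed
  finally show ?thesis
    using True by (simp add: alternating_def mmap3_mem_multilinear)
qed (simp add: alternating_def mmap3_mem_multilinear)

section \<open>The cohomology relation\<close>

lemma minus_mem_multilinear:
  fixes f f' :: "'a::ab_group_add list \<Rightarrow> 'b::ab_group_add"
  assumes "vector_space s" "vector_space u" "f \<in> multilinear s u n" "f' \<in> multilinear s u n"
  shows "f - f' \<in> multilinear s u n"
proof -
  interpret vector_space_pair s u using assms by (simp add: vector_space_pair_def)
  show ?thesis
    using assms(3,4) by (auto simp: multilinear_def intro: linear_compose_sub)
qed

lemma zero_mem_multilinear:
  assumes "vector_space s" "vector_space u"
  shows "0 \<in> multilinear s u n"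
proof -
  interpret vector_space_pair s u using assms by (simp add: vector_space_pair_def)
  show ?thesis
    using linear_zero by (auto simp: multilinear_def)
qed

lemma zero_mem_alie_cochains:
  assumes "vector_space s" "vector_space u"
  shows "0 \<in> alie_cochains s u n"
  using zero_mem_multilinear[OF assms]
  by (auto simp: alie_cochains_def alternating_def zero_prod_def)

lemma minus_mem_alie_cochains:
  assumes "vector_space s" "vector_space u" "c \<in> alie_cochains s u n" "c' \<in> alie_cochains s u n"
  shows "c - c' \<in> alie_cochains s u n"
  using assms minus_mem_multilinear[OF assms(1,2)]
  by (cases c; cases c') (auto simp: alie_cochains_def alternating_def zero_fun_def split: if_splits)

text \<open>The coboundary operator is a signed sum of composites with \<open>\<psi>\<close> and \<open>Q\<close>, so it is additive
  as soon as these are. Hence the coboundaries form a subgroup, which is what makes being cohomologous an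
  equivalence relation.\<close>

lemma alie_coboundary_minus:
  assumes "vector_space u" "\<And>x. Vector_Spaces.linear u u (\<psi> x)" "Vector_Spaces.linear u u Q"
  shows "alie_coboundary u br P \<psi> Q n (c - c') =
    alie_coboundary u br P \<psi> Q n c - alie_coboundary u br P \<psi> Q n c'"
proof -
  interpret vector_space_pair u u using assms(1) by (simp add: vector_space_pair_def)
  note lin = linear_diff[OF assms(2)] linear_diff[OF assms(3)] vs1.scale_right_diff_distrib
  show ?thesis
    by (cases c; cases c')
      (auto simp: alie_coboundary_def lie_coboundary_def leib_coboundary_def fun_eq_iff lin
        sum_subtractf sum_negf case_prod_unfold)
qed

lemma equiv_alie_cohomologous:
  assumes "vector_space s" "vector_space u" "\<And>x. Vector_Spaces.linear u u (\<psi> x)" "Vector_Spaces.linear u u Q"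
  shows "equiv (alie_cocycles s u br P \<psi> Q n) (alie_cohomologous s u br P \<psi> Q n)"
proof -
  let ?B = "alie_coboundaries s u br P \<psi> Q n"
  note cob = alie_coboundary_minus[where br = br and P = P, OF assms(2-4)]
  have diff: "b - b' \<in> ?B" if "b \<in> ?B" "b' \<in> ?B" for b b'
    using that minus_mem_alie_cochains[OF assms(1,2)]
    unfolding alie_coboundaries_def by (auto simp flip: cob)
  have "alie_coboundary u br P \<psi> Q (n - 1) (0 - 0) = 0"
    unfolding cob by simp
  then have zero: "0 \<in> ?B"
    unfolding alie_coboundaries_def
    by (metis diff_zero image_eqI zero_mem_alie_cochains[OF assms(1,2)])
  have "refl_on (alie_cocycles s u br P \<psi> Q n) (alie_cohomologous s u br P \<psi> Q n)"
    using zero by (auto simp: refl_on_def alie_cohomologous_def)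
  moreover have "sym (alie_cohomologous s u br P \<psi> Q n)"
  proof (rule symI)
    fix x y
    assume *: "(x, y) \<in> alie_cohomologous s u br P \<psi> Q n"
    then have "0 - (y - x) \<in> ?B"
      by (intro diff[OF zero]) (simp add: alie_cohomologous_def)
    then show "(y, x) \<in> alie_cohomologous s u br P \<psi> Q n"
      using * by (simp add: alie_cohomologous_def)
  qed
  moreover have "trans (alie_cohomologous s u br P \<psi> Q n)"
  proof (rule transI)
    fix x y z
    assume *: "(x, y) \<in> alie_cohomologous s u br P \<psi> Q n" "(y, z) \<in> alie_cohomologous s u br P \<psi> Q n"
    have "(z - y) - (0 - (y - x)) \<in> ?B"
      by (rule diff[OF _ diff[OF zero]]) (use * in \<open>simp_all add: alie_cohomologous_def\<close>)
    then show "(x, z) \<in> alie_cohomologous s u br P \<psi> Q n"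
      using * by (simp add: alie_cohomologous_def)
  qed
  ultimately show ?thesis
    by (intro equivI) (auto simp: alie_cohomologous_def)
qed

section \<open>Skeletal structures as 3-cocycles\<close>

lemma pairs_less_3: "{(i, j). i < j \<and> j < 3} = {(0, 1), (0, 2), (1, 2::nat)}"
  by (auto simp: eval_nat_numeral less_Suc_eq)

lemma pairs_less_4: "{(i, j). i < j \<and> j < 4} = {(0, 1), (0, 2), (0, 3), (1, 2), (1, 3), (2, 3::nat)}"
  by (auto simp: eval_nat_numeral less_Suc_eq)

lemma three_plus_one: "3 + 1 = (4::nat)"
  by simp

text \<open>For a skeletal structure this expression vanishes iff (L8) holds: the action terms are the left
  side of (L8) and the bracket terms are its right side.\<close>

lemma lie_coboundary_3:
  assumes "vector_space u"
  shows "lie_coboundary u br \<psi> 3 (mmap3 l) [w, x, y, z] =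
    \<psi> w (l x y z) - \<psi> x (l w y z) + \<psi> y (l w x z) - \<psi> z (l w x y)
    - (l (br w x) y z - l (br w y) x z + l (br w z) x y + l (br x y) w z - l (br x z) w y + l (br y z) w x)"
proof -
  interpret vector_space u by fact
  show ?thesis
    unfolding lie_coboundary_def three_plus_one pairs_less_4
    by (simp add: omit_def lessThan_Suc eval_nat_numeral algebra_simps)
qed

text \<open>This is the left side of (A4).\<close>

lemma leib_coboundary_3:
  assumes "vector_space u"
  shows "leib_coboundary u br P \<psi> Q 3 (mmap2 \<theta>) [x, y, z] =
    \<psi> (P x) (\<theta> y z) - \<psi> (P y) (\<theta> x z) + \<psi> (P z) (\<theta> x y) - Q (\<psi> z (\<theta> x y))
    - \<theta> (br (P x) y) z - \<theta> y (br (P x) z) + \<theta> x (br (P y) z)"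
proof -
  interpret vector_space u by fact
  show ?thesis
    unfolding leib_coboundary_def pairs_less_3
    by (simp add: omit_def lessThan_Suc eval_nat_numeral algebra_simps)
qed

lemma alie_cocycles_3_iff:
  fixes s :: "'k::field_char_0 \<Rightarrow> 'a::ab_group_add \<Rightarrow> 'a" and u :: "'k \<Rightarrow> 'b::ab_group_add \<Rightarrow> 'b"
  assumes "vector_space u"
  shows "(mmap3 l, mmap2 \<theta>) \<in> alie_cocycles s u br P \<psi> Q 3 \<longleftrightarrow>
    trilinear_map s u l \<and> skew3 l \<and> bilinear_map s s u \<theta> \<and>
    (\<forall>w x y z. \<psi> w (l x y z) - \<psi> x (l w y z) + \<psi> y (l w x z) - \<psi> z (l w x y) =
       l (br w x) y z - l (br w y) x z + l (br w z) x y + l (br x y) w z - l (br x z) w y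
       + l (br y z) w x) \<and>
    (\<forall>x y z. \<psi> (P x) (\<theta> y z) - \<psi> (P y) (\<theta> x z) + \<psi> (P z) (\<theta> x y)
       - Q (\<psi> z (\<theta> x y)) - \<theta> (br (P x) y) z - \<theta> y (br (P x) z) + \<theta> x (br (P y) z) =
       l (P x) (P y) (P z) - Q (l (P x) (P y) z))" (is "_ \<longleftrightarrow> _ \<and> _ \<and> _ \<and> ?L8 \<and> ?A4")
proof -
  interpret vector_space u by fact
  let ?c = "alie_coboundary u br P \<psi> Q 3 (mmap3 l, mmap2 \<theta>)"
  have "fst ?c = 0 \<longleftrightarrow> (\<forall>xs. length xs = 4 \<longrightarrow> fst ?c xs = 0)"
    by (auto simp: fun_eq_iff alie_coboundary_def lie_coboundary_def)
  also have "\<dots> \<longleftrightarrow> ?L8"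
    unfolding all_length_4
    by (simp only: alie_coboundary_def prod.case fst_conv lie_coboundary_3[OF assms] diff_eq_eq add_0)
  finally have L8: "fst ?c = 0 \<longleftrightarrow> ?L8" .
  have eval: "snd ?c [x, y, z] =
      (\<psi> (P x) (\<theta> y z) - \<psi> (P y) (\<theta> x z) + \<psi> (P z) (\<theta> x y)
       - Q (\<psi> z (\<theta> x y)) - \<theta> (br (P x) y) z - \<theta> y (br (P x) z) + \<theta> x (br (P y) z))
      - (l (P x) (P y) (P z) - Q (l (P x) (P y) z))" for x y z
    by (simp add: alie_coboundary_def leib_coboundary_3[OF assms])
  have "snd ?c = 0 \<longleftrightarrow> (\<forall>xs. length xs = 3 \<longrightarrow> snd ?c xs = 0)"
    by (auto simp: fun_eq_iff alie_coboundary_def leib_coboundary_def)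
  also have "\<dots> \<longleftrightarrow> ?A4"
    unfolding all_length_3 eval right_minus_eq ..
  finally have A4: "snd ?c = 0 \<longleftrightarrow> ?A4" .
  show ?thesis
    unfolding alie_cocycles_def alie_cochains_def mem_Collect_eq prod_eq_iff[of ?c] fst_zero snd_zero L8 A4
    by (simp add: mmap3_mem_alternating[OF assms] mmap2_mem_multilinear)
qed

text \<open>With \<open>d = 0\<close>, axiom (L6) becomes the Jacobi identity, (L7) the representation property, (A2) the
  averaging identity of \<open>P\<^sub>0\<close>, and (A3) the two compatibility conditions on \<open>Q = P\<^sub>1\<close>; skew-symmetry
  of the bracket is \<open>[x, x] = 0\<close> because 2 is invertible. The bracket on \<open>\<gg>\<^sub>1 \<times> \<gg>\<^sub>0\<close> is
  determined by (L2).\<close>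

lemma skeletal_bilinear_averaging_linf_iff:
  fixes s :: "'k::field_char_0 \<Rightarrow> 'a::ab_group_add \<Rightarrow> 'a" and u :: "'k \<Rightarrow> 'b::ab_group_add \<Rightarrow> 'b"
  assumes "vector_space s" "vector_space u"
  shows "A \<in> skeletal_bilinear_averaging_linf s u \<longleftrightarrow>
    averaging_lie_algebra s (br00 A) (avg0 A) \<and>
    averaging_representation s u (br00 A) (avg0 A) (br01 A) (avg1 A) \<and>
    linf_cochain A \<in> alie_cocycles s u (br00 A) (avg0 A) (br01 A) (avg1 A) 3 \<and>
    diff A = (\<lambda>_. 0) \<and> br10 A = (\<lambda>h x. - br01 A x h)" (is "?L \<longleftrightarrow> ?R")
proof -
  interpret vector_space_pair s u using assms by (simp add: vector_space_pair_def)
  interpret ss: vector_space_pair s s using assms by (simp add: vector_space_pair_def)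
  interpret uu: vector_space_pair u u using assms by (simp add: vector_space_pair_def)
  have lin0: "Vector_Spaces.linear u s (\<lambda>_. 0)"
    by (simp add: Vector_Spaces.linear_iff assms)
  have neg: "bilinear_map u s u (\<lambda>h x. - br01 A x h)" if "bilinear_map s u u (br01 A)"
    using that unfolding bilinear_map_def
    by (auto simp: Vector_Spaces.linear_iff)
  show ?thesis
  proof
    assume L: ?L
    then have d: "diff A = (\<lambda>_. 0)"
      by (simp add: skeletal_bilinear_averaging_linf_def)
    from L have linf: "bilinear_map s s s (br00 A)" "bilinear_map s u u (br01 A)"
        "bilinear_map u s u (br10 A)" "trilinear_map s u (tern A)" "skew3 (tern A)"
        and skew: "skew2 (br00 A)"
        and b10: "\<And>x h. br01 A x h = - br10 A h x"
        and jac: "\<And>x y z. 0 = br00 A x (br00 A y z) + br00 A y (br00 A z x) + br00 A z (br00 A x y)"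
        and rep: "\<And>x y h. tern A x y 0 =
          br01 A x (br01 A y h) + br01 A y (br10 A h x) + br10 A h (br00 A x y)"
        and L8: "\<forall>w x y z. br01 A w (tern A x y z) - br01 A x (tern A w y z)
          + br01 A y (tern A w x z) - br01 A z (tern A w x y) =
          tern A (br00 A w x) y z - tern A (br00 A w y) x z + tern A (br00 A w z) x y
          + tern A (br00 A x y) w z - tern A (br00 A x z) w y + tern A (br00 A y z) w x"
      unfolding skeletal_bilinear_averaging_linf_def two_term_linf_def Let_def mem_Collect_eq skew2_def d
      by blast+
    from L have avg: "Vector_Spaces.linear s s (avg0 A)" "Vector_Spaces.linear u u (avg1 A)"
        "bilinear_map s s u (avg2 A)"
        and A2: "\<And>x y. 0 = avg0 A (br00 A (avg0 A x) y) - br00 A (avg0 A x) (avg0 A y)"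
        and A3: "\<And>x h. avg2 A x 0 = avg1 A (br01 A (avg0 A x) h) - br01 A (avg0 A x) (avg1 A h)"
          "\<And>x h. avg2 A x 0 = avg1 A (br01 A x (avg1 A h)) - br01 A (avg0 A x) (avg1 A h)"
        and A4: "\<forall>x y z. br01 A (avg0 A x) (avg2 A y z) - br01 A (avg0 A y) (avg2 A x z)
          + br01 A (avg0 A z) (avg2 A x y) - avg1 A (br01 A z (avg2 A x y))
          - avg2 A (br00 A (avg0 A x) y) z - avg2 A y (br00 A (avg0 A x) z) + avg2 A x (br00 A (avg0 A y) z) =
          tern A (avg0 A x) (avg0 A y) (avg0 A z) - avg1 A (tern A (avg0 A x) (avg0 A y) z)"
      unfolding skeletal_bilinear_averaging_linf_def bilinear_homotopy_averaging_def Let_def mem_Collect_eq d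
      by blast+
    have l0: "tern A x y 0 = 0" and \<theta>0: "avg2 A x 0 = 0" and neg01: "br01 A x (- h) = - br01 A x h" for x y h
      using linf(2,4) avg linear_0 uu.linear_neg by (auto simp: trilinear_map_def bilinear_map_def)
    have b10': "br10 A = (\<lambda>h x. - br01 A x h)"
      using b10 by auto
    have "averaging_lie_algebra s (br00 A) (avg0 A)"
      unfolding averaging_lie_algebra_def lie_algebra_def
      using linf(1) skew skew2_iff_diag_zero[OF assms(1) linf(1)] jac[symmetric] A2 avg(1) by simp
    moreover have "averaging_representation s u (br00 A) (avg0 A) (br01 A) (avg1 A)"
      unfolding averaging_representation_def lie_representation_def
      using linf(2) avg(2) A3 rep by (simp add: l0 \<theta>0 b10' neg01 algebra_simps)
    moreover have "linf_cochain A \<in> alie_cocycles s u (br00 A) (avg0 A) (br01 A) (avg1 A) 3"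
      unfolding linf_cochain_def alie_cocycles_3_iff[OF assms(2)]
      using linf avg L8 A4 by blast
    ultimately show ?R
      using d b10' by blast
  next
    assume R: ?R
    then have d: "diff A = (\<lambda>_. 0)" and b10: "br10 A = (\<lambda>h x. - br01 A x h)" by simp_all
    from R have lie: "bilinear_map s s s (br00 A)" "\<forall>x. br00 A x x = 0"
      "\<And>x y z. br00 A x (br00 A y z) + br00 A y (br00 A z x) + br00 A z (br00 A x y) = 0"
      "Vector_Spaces.linear s s (avg0 A)"
      "\<And>x y. br00 A (avg0 A x) (avg0 A y) = avg0 A (br00 A (avg0 A x) y)"
      by (simp_all add: averaging_lie_algebra_def lie_algebra_def)
    from R have rep: "bilinear_map s u u (br01 A)"
      "\<And>x y v. br01 A (br00 A x y) v = br01 A x (br01 A y v) - br01 A y (br01 A x v)"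
      "Vector_Spaces.linear u u (avg1 A)"
      "\<And>x v. br01 A (avg0 A x) (avg1 A v) = avg1 A (br01 A (avg0 A x) v)"
      "\<And>x v. avg1 A (br01 A (avg0 A x) v) = avg1 A (br01 A x (avg1 A v))"
      by (simp_all add: averaging_representation_def lie_representation_def)
    have coc: "trilinear_map s u (tern A) \<and> skew3 (tern A) \<and> bilinear_map s s u (avg2 A) \<and>
      (\<forall>w x y z. br01 A w (tern A x y z) - br01 A x (tern A w y z)
          + br01 A y (tern A w x z) - br01 A z (tern A w x y) =
          tern A (br00 A w x) y z - tern A (br00 A w y) x z + tern A (br00 A w z) x y
          + tern A (br00 A x y) w z - tern A (br00 A x z) w y + tern A (br00 A y z) w x) \<and>
      (\<forall>x y z. br01 A (avg0 A x) (avg2 A y z) - br01 A (avg0 A y) (avg2 A x z)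
          + br01 A (avg0 A z) (avg2 A x y) - avg1 A (br01 A z (avg2 A x y))
          - avg2 A (br00 A (avg0 A x) y) z - avg2 A y (br00 A (avg0 A x) z) + avg2 A x (br00 A (avg0 A y) z) =
          tern A (avg0 A x) (avg0 A y) (avg0 A z) - avg1 A (tern A (avg0 A x) (avg0 A y) z))"
      using R unfolding linf_cochain_def alie_cocycles_3_iff[OF assms(2)] by blast
    note tern = coc[THEN conjunct1] coc[THEN conjunct2, THEN conjunct1]
      coc[THEN conjunct2, THEN conjunct2, THEN conjunct2, THEN conjunct1]
    have zero: "tern A x y 0 = 0" "avg2 A x 0 = 0" "br00 A x 0 = 0" "br01 A x (- h) = - br01 A x h" "avg0 A 0 = 0"
      for x y h
      using coc lie(1,4) rep(1) linear_0 uu.linear_neg ss.linear_0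
      by (auto simp: trilinear_map_def bilinear_map_def)
    have zero01: "br01 A 0 h = 0" for h
      using rep(1) linear_0[of "\<lambda>x. br01 A x h"] uu.linear_0 by (simp add: bilinear_map_def)
    have skew: "\<forall>x y. br00 A x y = - br00 A y x"
      using skew2_iff_diag_zero[OF assms(1) lie(1)] lie(2) unfolding skew2_def by blast
    have "two_term_linf s u A"
      unfolding two_term_linf_def Let_def d b10
      by (intro conjI; (fact lin0 lie(1) rep(1) neg[OF rep(1)] skew tern | simp add: zero zero01 lie(3) rep(2)))
    moreover have "bilinear_homotopy_averaging s u A"
      unfolding bilinear_homotopy_averaging_def Let_def d
      using coc lie(4) rep(3)
      by (simp add: zero zero01 lie(5) rep(4,5) comp_def)
    ultimately show ?L
      using d by (simp add: skeletal_bilinear_averaging_linf_def)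
  qed
qed

section \<open>Classes of skeletal structures as cohomology classes\<close>

lemma bij_betw_quotient_kernel:
  assumes "r = {(x, y). x \<in> S \<and> y \<in> S \<and> F x = F y}"
  obtains \<Phi> where "bij_betw \<Phi> (S // r) (F ` S)" and "\<And>x. x \<in> S \<Longrightarrow> \<Phi> (r `` {x}) = F x"
proof -
  define \<Phi> where "\<Phi> X = F (SOME x. x \<in> X)" for X
  have val: "\<Phi> (r `` {x}) = F x" if "x \<in> S" for x
  proof -
    have "x \<in> r `` {x}" using that by (simp add: assms)
    then have "(SOME y. y \<in> r `` {x}) \<in> r `` {x}" by (rule someI)
    moreover have "\<forall>y\<in>r `` {x}. F y = F x" by (auto simp: assms)
    ultimately show ?thesis unfolding \<Phi>_def by blast
  qed
  have "bij_betw \<Phi> (S // r) (F ` S)"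
  proof (rule bij_betwI')
    fix X Y assume "X \<in> S // r" "Y \<in> S // r"
    then obtain x y where xy: "x \<in> S" "X = r `` {x}" "y \<in> S" "Y = r `` {y}"
      by (auto elim!: quotientE)
    then show "\<Phi> X = \<Phi> Y \<longleftrightarrow> X = Y"
      using val by (auto simp: assms)
  next
    fix X assume "X \<in> S // r"
    then show "\<Phi> X \<in> F ` S" by (auto elim!: quotientE simp: val)
  next
    fix z assume "z \<in> F ` S"
    then obtain x where "x \<in> S" "z = F x" by blast
    then show "\<exists>X\<in>S // r. z = \<Phi> X" using quotientI[of x S r] val by metis
  qed
  then show ?thesis using val that by blast
qed

lemma alie_cochains_2_eq:
  fixes s :: "'k::field_char_0 \<Rightarrow> 'a::ab_group_add \<Rightarrow> 'a" and u :: "'k \<Rightarrow> 'b::ab_group_add \<Rightarrow> 'b"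
  assumes "vector_space u"
  shows "alie_cochains s u 2 =
    {(mmap2 g, mmap1 t) | g t. bilinear_map s s u g \<and> skew2 g \<and> Vector_Spaces.linear s u t}"
proof (intro equalityI subsetI)
  fix c assume "c \<in> alie_cochains s u 2"
  then have c: "fst c \<in> alternating s u 2" "snd c \<in> multilinear s u 1"
    by (auto simp: alie_cochains_def)
  define g t where "g = (\<lambda>x y. fst c [x, y])" and "t = (\<lambda>x. snd c [x])"
  have "fst c = mmap2 g"
    unfolding g_def by (rule multilinear_2_eq_mmap2[of _ s u]) (use c(1) in \<open>simp add: alternating_def\<close>)
  moreover have "snd c = mmap1 t"
    unfolding t_def by (rule multilinear_1_eq_mmap1[OF c(2)])
  ultimately have "c = (mmap2 g, mmap1 t)"
    by (simp add: prod_eq_iff)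
  then show "c \<in> {(mmap2 g, mmap1 t) | g t. bilinear_map s s u g \<and> skew2 g \<and> Vector_Spaces.linear s u t}"
    using c mmap2_mem_alternating[OF assms, of g s] mmap1_mem_multilinear[of t s u] by auto
next
  fix c assume "c \<in> {(mmap2 g, mmap1 t) | g t. bilinear_map s s u g \<and> skew2 g \<and> Vector_Spaces.linear s u t}"
  then show "c \<in> alie_cochains s u 2"
    unfolding alie_cochains_def
    by (auto simp: mmap2_mem_alternating[OF assms] mmap1_mem_multilinear[unfolded One_nat_def])
qed

lemma alie_cocycles_3_cases:
  assumes "c \<in> alie_cocycles s u br P \<psi> Q 3"
  obtains l \<theta> where "c = (mmap3 l, mmap2 \<theta>)"
proof -
  from assms have c: "fst c \<in> multilinear s u 3" "snd c \<in> multilinear s u 2"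
    by (auto simp: alie_cocycles_def alie_cochains_def alternating_def)
  have "c = (mmap3 (\<lambda>x y z. fst c [x, y, z]), mmap2 (\<lambda>x y. snd c [x, y]))"
    unfolding prod_eq_iff fst_conv snd_conv
    using multilinear_3_eq_mmap3[OF c(1)] multilinear_2_eq_mmap2[OF c(2)] ..
  then show ?thesis using that by blast
qed

lemma equiv_alie_cohomologous_representation:
  assumes "vector_space s" "vector_space u" and "averaging_representation s u br P \<psi> Q"
  shows "equiv (alie_cocycles s u br P \<psi> Q n) (alie_cohomologous s u br P \<psi> Q n)"
  using assms
  by (intro equiv_alie_cohomologous)
    (auto simp: averaging_representation_def lie_representation_def bilinear_map_def)

lemma alie_cohomology_representative:
  assumes R: "equiv (alie_cocycles s u br P \<psi> Q n) (alie_cohomologous s u br P \<psi> Q n)"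
    and c: "c \<in> alie_cohomology s u br P \<psi> Q n" "z \<in> c"
  shows "z \<in> alie_cocycles s u br P \<psi> Q n" and "c = alie_cohomologous s u br P \<psi> Q n `` {z}"
proof -
  from c(1) obtain y where y: "c = alie_cohomologous s u br P \<psi> Q n `` {y}"
    by (auto simp: alie_cohomology_def elim: quotientE)
  with c(2) have yz: "(y, z) \<in> alie_cohomologous s u br P \<psi> Q n" by blast
  then show "z \<in> alie_cocycles s u br P \<psi> Q n" by (simp add: alie_cohomologous_def)
  show "c = alie_cohomologous s u br P \<psi> Q n `` {z}"
    unfolding y by (rule equiv_class_eq[OF R yz])
qed

text \<open>A 2-cochain is the same as a pair of a skew-symmetric bilinear map and a linear map, so the
  witnesses demanded by \<^const>\<open>skeletal_equiv\<close> are exactly the 2-cochains whose coboundary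
  relates the two cocycles. The set \<open>S\<close> is arbitrary so that the result serves both for bilinear
  and for skew-symmetric \<open>P\<^sub>2\<close>.\<close>

lemma skeletal_equiv_eq_kernel:
  fixes s :: "'k::field_char_0 \<Rightarrow> 'a::ab_group_add \<Rightarrow> 'a" and u :: "'k \<Rightarrow> 'b::ab_group_add \<Rightarrow> 'b"
  assumes vs: "vector_space s" "vector_space u" and S: "S \<subseteq> skeletal_bilinear_averaging_linf s u"
  shows "skeletal_equiv s u S = {(A, A'). A \<in> S \<and> A' \<in> S \<and> linf_triple s u A = linf_triple s u A'}"
proof -
  have "(A, A') \<in> skeletal_equiv s u S \<longleftrightarrow> linf_triple s u A = linf_triple s u A'"
    if "A \<in> S" "A' \<in> S" for A A'
  proof (cases "br00 A = br00 A' \<and> br01 A = br01 A' \<and> avg0 A = avg0 A' \<and> avg1 A = avg1 A'")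
    case True
    let ?R = "alie_cohomologous s u (br00 A) (avg0 A) (br01 A) (avg1 A) 3"
    let ?\<delta> = "alie_coboundary u (br00 A) (avg0 A) (br01 A) (avg1 A) 2"
    note iff = skeletal_bilinear_averaging_linf_iff[OF vs]
    have A: "averaging_representation s u (br00 A) (avg0 A) (br01 A) (avg1 A)"
      "br10 A = br10 A'"
      "linf_cochain A \<in> alie_cocycles s u (br00 A) (avg0 A) (br01 A) (avg1 A) 3"
      "linf_cochain A' \<in> alie_cocycles s u (br00 A) (avg0 A) (br01 A) (avg1 A) 3"
      using that S iff[of A] iff[of A'] True by auto
    have "linf_triple s u A = linf_triple s u A' \<longleftrightarrow> ?R `` {linf_cochain A} = ?R `` {linf_cochain A'}"
      using True by (simp add: linf_triple_def)
    also have "\<dots> \<longleftrightarrow> (linf_cochain A, linf_cochain A') \<in> ?R"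
      by (rule eq_equiv_class_iff[OF equiv_alie_cohomologous_representation[OF vs A(1)] A(3,4)])
    also have "\<dots> \<longleftrightarrow> linf_cochain A' - linf_cochain A \<in> ?\<delta> ` alie_cochains s u 2"
      using A by (simp add: alie_cohomologous_def alie_coboundaries_def)
    also have "\<dots> \<longleftrightarrow> (\<exists>c\<in>alie_cochains s u 2. linf_cochain A' = linf_cochain A + ?\<delta> c)"
      by (auto simp: image_iff algebra_simps)
    also have "\<dots> \<longleftrightarrow> (A, A') \<in> skeletal_equiv s u S"
      using that True A(2) unfolding alie_cochains_2_eq[OF vs(2)] skeletal_equiv_def by auto
    finally show ?thesis by blast
  qed (auto simp: skeletal_equiv_def linf_triple_def)
  then show ?thesis by (auto simp: skeletal_equiv_def)
qed

lemma linf_triple_mem_alie_triples: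
  fixes s :: "'k::field_char_0 \<Rightarrow> 'a::ab_group_add \<Rightarrow> 'a" and u :: "'k \<Rightarrow> 'b::ab_group_add \<Rightarrow> 'b"
  assumes "vector_space s" "vector_space u" and "A \<in> skeletal_bilinear_averaging_linf s u"
  shows "linf_triple s u A \<in> alie_triples s u"
  using assms(3) unfolding skeletal_bilinear_averaging_linf_iff[OF assms(1,2)]
  by (auto simp: linf_triple_def alie_triples_def alie_cohomology_def intro: quotientI)

lemma cocycle_eq_linf_cochain:
  fixes s :: "'k::field_char_0 \<Rightarrow> 'a::ab_group_add \<Rightarrow> 'a" and u :: "'k \<Rightarrow> 'b::ab_group_add \<Rightarrow> 'b"
  assumes "vector_space s" "vector_space u"
    and "averaging_lie_algebra s br P" "averaging_representation s u br P \<psi> Q"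
    and "(mmap3 l, mmap2 \<theta>) \<in> alie_cocycles s u br P \<psi> Q 3"
  obtains A where "A \<in> skeletal_bilinear_averaging_linf s u" "avg2 A = \<theta>"
    "linf_triple s u A = ((br, P), (\<psi>, Q), alie_cohomologous s u br P \<psi> Q 3 `` {(mmap3 l, mmap2 \<theta>)})"
proof
  let ?A = "\<lparr>diff = (\<lambda>_. 0), br00 = br, br01 = \<psi>, br10 = (\<lambda>h x. - \<psi> x h), tern = l,
    avg0 = P, avg1 = Q, avg2 = \<theta>\<rparr>"
  show "?A \<in> skeletal_bilinear_averaging_linf s u"
    using assms(3-5) by (simp add: skeletal_bilinear_averaging_linf_iff[OF assms(1,2)] linf_cochain_def)
qed (simp_all add: linf_triple_def linf_cochain_def)

lemma linf_triple_image:
  fixes s :: "'k::field_char_0 \<Rightarrow> 'a::ab_group_add \<Rightarrow> 'a" and u :: "'k \<Rightarrow> 'b::ab_group_add \<Rightarrow> 'b"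
  assumes vs: "vector_space s" "vector_space u"
  shows "linf_triple s u ` skeletal_bilinear_averaging_linf s u = alie_triples s u"
proof (intro equalityI subsetI)
  fix T assume "T \<in> alie_triples s u"
  then obtain br P \<psi> Q c where T: "T = ((br, P), (\<psi>, Q), c)"
      "averaging_lie_algebra s br P" "averaging_representation s u br P \<psi> Q"
      and "c \<in> alie_cohomology s u br P \<psi> Q 3"
    by (auto simp: alie_triples_def)
  then obtain z where z: "z \<in> alie_cocycles s u br P \<psi> Q 3"
      "c = alie_cohomologous s u br P \<psi> Q 3 `` {z}"
    by (auto simp: alie_cohomology_def elim: quotientE)
  obtain l \<theta> where "z = (mmap3 l, mmap2 \<theta>)"
    using z(1) by (rule alie_cocycles_3_cases)
  with z T show "T \<in> linf_triple s u ` skeletal_bilinear_averaging_linf s u"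
    by (metis cocycle_eq_linf_cochain[OF vs] image_eqI)
qed (use linf_triple_mem_alie_triples[OF vs] in blast)

lemma skeletal_averaging_linf_eq:
  "skeletal_averaging_linf s u = {A \<in> skeletal_bilinear_averaging_linf s u. skew2 (avg2 A)}"
  by (auto simp: skeletal_averaging_linf_def skeletal_bilinear_averaging_linf_def homotopy_averaging_def)

text \<open>A skew-symmetric \<open>\<theta>\<close> in some class \<open>c\<close> belongs to a cocycle representing \<open>c\<close>, and the structure
  built from this cocycle has \<open>P\<^sub>2 = \<theta>\<close>.\<close>

lemma linf_triple_image_skew:
  fixes s :: "'k::field_char_0 \<Rightarrow> 'a::ab_group_add \<Rightarrow> 'a" and u :: "'k \<Rightarrow> 'b::ab_group_add \<Rightarrow> 'b"
  assumes vs: "vector_space s" "vector_space u"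
  shows "linf_triple s u ` skeletal_averaging_linf s u =
    {(g, V, c) \<in> alie_triples s u. \<exists>f \<theta>. (f, mmap2 \<theta>) \<in> c \<and> skew2 \<theta>}" (is "_ = ?T'")
proof (intro equalityI subsetI)
  fix T assume "T \<in> linf_triple s u ` skeletal_averaging_linf s u"
  then obtain A where A: "A \<in> skeletal_bilinear_averaging_linf s u" "skew2 (avg2 A)" "T = linf_triple s u A"
    by (auto simp: skeletal_averaging_linf_eq)
  have "linf_cochain A \<in> alie_cohomologous s u (br00 A) (avg0 A) (br01 A) (avg1 A) 3 `` {linf_cochain A}"
    using A(1) unfolding skeletal_bilinear_averaging_linf_iff[OF vs]
    by (meson equiv_class_self equiv_alie_cohomologous_representation[OF vs])
  then have "\<exists>f \<theta>. (f, mmap2 \<theta>) \<in> snd (snd T) \<and> skew2 \<theta>"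
    using A(2,3) by (auto simp: linf_triple_def linf_cochain_def)
  moreover have "T \<in> alie_triples s u"
    using linf_triple_mem_alie_triples[OF vs A(1)] A(3) by simp
  ultimately show "T \<in> ?T'"
    by (simp add: case_prod_unfold)
next
  fix T assume "T \<in> ?T'"
  then obtain br P \<psi> Q c f \<theta> where T: "T = ((br, P), (\<psi>, Q), c)"
      "averaging_lie_algebra s br P" "averaging_representation s u br P \<psi> Q"
      and c: "c \<in> alie_cohomology s u br P \<psi> Q 3" "(f, mmap2 \<theta>) \<in> c" "skew2 \<theta>"
    by (auto simp: alie_triples_def)
  note f = alie_cohomology_representative[OF equiv_alie_cohomologous_representation[OF vs T(3)] c(1,2)]
  obtain l where "f = mmap3 l"
    using alie_cocycles_3_cases[OF f(1)] by blast
  with f T c(3) show "T \<in> linf_triple s u ` skeletal_averaging_linf s u"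
    unfolding skeletal_averaging_linf_eq
    by (smt (verit) cocycle_eq_linf_cochain[OF vs] image_eqI mem_Collect_eq)
qed

section \<open>Counting triples\<close>

text \<open>The induction replaces the arguments by spanning vectors one position at a time: after \<open>k\<close> steps,
  equality is known for all lists whose entries from position \<open>k\<close> on lie in \<open>B\<close>.\<close>

lemma multilinear_eqI_on_spanning:
  assumes f: "f \<in> multilinear s u n" and f': "f' \<in> multilinear s u n"
    and span: "module.span s B = UNIV"
    and eq: "\<And>xs. length xs = n \<Longrightarrow> set xs \<subseteq> B \<Longrightarrow> f xs = f' xs"
  shows "f = f'"
proof
  fix xs
  have "f xs = f' xs" if "length xs = n" "set (drop k xs) \<subseteq> B" "k \<le> n" for k xs
    using that
  proof (induction k arbitrary: xs)
    case 0
    then show ?case by (simp add: eq)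
  next
    case (Suc k)
    have lin: "Vector_Spaces.linear s u (\<lambda>x. f (xs[k := x]))" "Vector_Spaces.linear s u (\<lambda>x. f' (xs[k := x]))"
      using Suc.prems f f' by (auto simp: multilinear_def)
    then interpret vector_space_pair s u
      by (simp add: Vector_Spaces.linear_iff vector_space_pair_def)
    have "f (xs[k := b]) = f' (xs[k := b])" if "b \<in> B" for b
    proof (rule Suc.IH)
      have "drop k (xs[k := b]) = b # drop (Suc k) xs"
        using Suc.prems by (simp add: drop_update_swap Cons_nth_drop_Suc[symmetric])
      then show "set (drop k (xs[k := b])) \<subseteq> B"
        using Suc.prems that by simp
    qed (use Suc.prems in auto)
    then have "f (xs[k := xs ! k]) = f' (xs[k := xs ! k])"
      using linear_eq_on[OF lin, of "xs ! k" B] by (simp add: span)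
    then show ?case by simp
  qed
  from this[of xs n] show "f xs = f' xs"
    using f f' by (cases "length xs = n") (auto simp: multilinear_def)
qed

lemma bilinear_map_eqI_on_spanning:
  assumes b: "bilinear_map s t u b" and b': "bilinear_map s t u b'"
    and span: "module.span s B = UNIV" "module.span t C = UNIV"
    and eq: "\<And>x y. x \<in> B \<Longrightarrow> y \<in> C \<Longrightarrow> b x y = b' x y"
  shows "b = b'"
proof (intro ext)
  fix x y
  note lin = b[unfolded bilinear_map_def] b'[unfolded bilinear_map_def]
  interpret su: vector_space_pair s u
    using lin by (simp add: Vector_Spaces.linear_iff vector_space_pair_def)
  interpret tu: vector_space_pair t u
    using lin by (simp add: Vector_Spaces.linear_iff vector_space_pair_def)
  have "b x y = b' x y" if "x \<in> B" for x
    using lin that by (intro tu.linear_eq_on[of "b x" "b' x" y C]) (auto simp: span eq)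
  then show "b x y = b' x y"
    using lin by (intro su.linear_eq_on[of "\<lambda>x. b x y" "\<lambda>x. b' x y" x B]) (auto simp: span)
qed

lemma linear_eqI_on_spanning:
  assumes f: "Vector_Spaces.linear s u f" and f': "Vector_Spaces.linear s u f'"
    and span: "module.span s B = UNIV" and eq: "\<And>x. x \<in> B \<Longrightarrow> f x = f' x"
  shows "f = f'"
proof
  fix x
  interpret vector_space_pair s u
    using f by (simp add: Vector_Spaces.linear_iff vector_space_pair_def)
  show "f x = f' x"
    by (rule linear_eq_on[OF f f', of x B]) (auto simp: span eq)
qed

lemma funcset_finite_lepoll:
  assumes "finite K" "infinite X"
  shows "K \<rightarrow>\<^sub>E X \<lesssim> X"
  using assms(1)
proof (induction K rule: finite_induct)
  case empty
  have "X \<noteq> {}" using assms(2) by auto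
  then show ?case by (auto simp: lepoll_def)
next
  case (insert a K)
  have "insert a K \<rightarrow>\<^sub>E X \<lesssim> X \<times> (K \<rightarrow>\<^sub>E X)"
    unfolding PiE_insert_eq by (rule image_lepoll)
  also have "\<dots> \<lesssim> X \<times> X"
    by (rule times_lepoll_mono[OF lepoll_refl insert.IH])
  also have "\<dots> \<approx> X"
    using card_of_Times_same_infinite[OF assms(2)] by (simp add: eqpoll_iff_card_of_ordIso)
  finally show ?case .
qed

text \<open>If \<open>B\<close> is infinite, then \<open>6 \<times> B\<^sup>3\<close> is no larger than \<open>B\<close>. If \<open>B\<close> is finite, then
  already \<open>X\<close> itself is as large as every finite power of \<open>X\<close>. The case of a singleton \<open>X\<close>
  corresponds to the zero vector space, whose basis is empty.\<close>

lemma funcset_multi_lepoll: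
  fixes X :: "'w set"
  assumes X: "infinite X \<and> B \<noteq> {} \<or> (\<exists>a. X = {a})"
  shows "({..<6::nat} \<times> B \<times> B \<times> B) \<rightarrow>\<^sub>E X \<lesssim> B \<rightarrow>\<^sub>E X" (is "?K \<rightarrow>\<^sub>E X \<lesssim> _")
proof -
  consider a where "X = {a}" | "infinite X" "finite B" "B \<noteq> {}" | "infinite X" "infinite B"
    using X by blast
  then show ?thesis
  proof cases
    case 1
    then show ?thesis by (auto simp: PiE_eq_singleton lepoll_def)
  next
    case 2
    then obtain b where b: "b \<in> B" by blast
    have "?K \<rightarrow>\<^sub>E X \<lesssim> X"
      using 2 by (intro funcset_finite_lepoll) auto
    also have "X \<approx> {b} \<rightarrow>\<^sub>E X"
      by (rule eqpoll_sym[OF PiE_sing_eqpoll_self])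
    also have "\<dots> \<lesssim> B \<rightarrow>\<^sub>E X"
      using 2 b by (intro lepoll_funcset_left) (auto intro: subset_imp_lepoll)
    finally show ?thesis .
  next
    case 3
    have sq: "B \<times> B \<lesssim> B"
      using card_of_Times_same_infinite[OF 3(2)]
      by (metis eqpoll_iff_card_of_ordIso eqpoll_imp_lepoll)
    have "{..<6::nat} \<lesssim> B"
      using 3 by (intro finite_lepoll_infinite) auto
    then have "?K \<lesssim> B \<times> (B \<times> (B \<times> B))"
      by (intro times_lepoll_mono lepoll_refl)
    also have "\<dots> \<lesssim> B \<times> (B \<times> B)"
      by (intro times_lepoll_mono lepoll_refl sq)
    also have "\<dots> \<lesssim> B \<times> B"
      by (intro times_lepoll_mono lepoll_refl sq)
    also note sq
    finally show ?thesis
      using 3 by (intro lepoll_funcset_left) auto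
  qed
qed

text \<open>The maps \<open>p\<close> and \<open>q\<close> let a single set \<open>B\<close> index spanning families of both spaces, and \<open>i\<close>, \<open>j\<close> put all
  values into a single type; this makes the bound symmetric in the two spaces. A
  triple is encoded by the values of its six maps on spanning vectors, padded to three arguments.
  The cohomology class enters through a representative chosen by \<open>rep\<close>; equal representatives give
  equal classes because the brackets and operators, which define the cohomology relation, have
  already been recovered.\<close>

lemma alie_triples_lepoll:
  fixes s :: "'k::field_char_0 \<Rightarrow> 'a::ab_group_add \<Rightarrow> 'a" and u :: "'k \<Rightarrow> 'b::ab_group_add \<Rightarrow> 'b"
    and B :: "'w set" and p :: "'w \<Rightarrow> 'a" and q :: "'w \<Rightarrow> 'b"
  assumes vs: "vector_space s" "vector_space u"
    and span: "module.span s (p ` B) = UNIV" "module.span u (q ` B) = UNIV"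
    and inj: "inj (i :: 'a \<Rightarrow> 'w)" "inj (j :: 'b \<Rightarrow> 'w)"
  shows "alie_triples s u \<lesssim> ({..<6::nat} \<times> B \<times> B \<times> B) \<rightarrow>\<^sub>E (UNIV :: 'w set)"
proof -
  define rep where "rep c = (SOME z. z \<in> c)" for c :: "(('a list \<Rightarrow> 'b) \<times> ('a list \<Rightarrow> 'b)) set"
  define code :: "('a, 'b) alie_triple \<Rightarrow> nat \<times> 'w \<times> 'w \<times> 'w \<Rightarrow> 'w" where
    "code = (\<lambda>((br, P), (\<psi>, Q), c). \<lambda>(n, x, y, z) \<in> {..<6} \<times> B \<times> B \<times> B.
       [i (br (p x) (p y)), i (P (p x)), j (\<psi> (p x) (q y)), j (Q (q x)),
        j (fst (rep c) [p x, p y, p z]), j (snd (rep c) [p x, p y])] ! n)"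
  have "inj_on code (alie_triples s u)"
  proof (rule inj_onI)
    fix T T' assume "T \<in> alie_triples s u" "T' \<in> alie_triples s u" and codes: "code T = code T'"
    then obtain br P \<psi> Q c br' P' \<psi>' Q' c' where
      T: "T = ((br, P), (\<psi>, Q), c)" "averaging_lie_algebra s br P"
        "averaging_representation s u br P \<psi> Q" "c \<in> alie_cohomology s u br P \<psi> Q 3" and
      T': "T' = ((br', P'), (\<psi>', Q'), c')" "averaging_lie_algebra s br' P'"
        "averaging_representation s u br' P' \<psi>' Q'" "c' \<in> alie_cohomology s u br' P' \<psi>' Q' 3"
      unfolding alie_triples_def by blast
    have eq: "code T (n, x, y, z) = code T' (n, x, y, z)" for n x y z
      by (simp add: codes)
    have rep: "rep c \<in> alie_cocycles s u br P \<psi> Q 3" "c = alie_cohomologous s u br P \<psi> Q 3 `` {rep c}"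
      if "averaging_representation s u br P \<psi> Q" "c \<in> alie_cohomology s u br P \<psi> Q 3"
      for br P \<psi> Q c
    proof -
      note R = equiv_alie_cohomologous_representation[OF vs that(1), where n = 3]
      have "c \<noteq> {}"
        using that(2) in_quotient_imp_non_empty[OF R] by (simp add: alie_cohomology_def)
      then have "rep c \<in> c"
        unfolding rep_def by (simp add: some_in_eq)
      then show "rep c \<in> alie_cocycles s u br P \<psi> Q 3" "c = alie_cohomologous s u br P \<psi> Q 3 `` {rep c}"
        using alie_cohomology_representative[OF R that(2)] by blast+
    qed
    have br_eq: "br (p x) (p y) = br' (p x) (p y)" and P_eq: "P (p x) = P' (p x)"
      and \<psi>_eq: "\<psi> (p x) (q y) = \<psi>' (p x) (q y)" and Q_eq: "Q (q x) = Q' (q x)"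
      and f_eq: "fst (rep c) [p x, p y, p z] = fst (rep c') [p x, p y, p z]"
      and \<theta>_eq: "snd (rep c) [p x, p y] = snd (rep c') [p x, p y]"
      if "x \<in> B" "y \<in> B" "z \<in> B" for x y z
      using that eq[of 0 x y z] eq[of 1 x y z] eq[of 2 x y z] eq[of 3 x y z] eq[of 4 x y z] eq[of 5 x y z] inj
      by (simp_all add: T(1) T'(1) code_def inj_eq)
    have br: "br = br'"
    proof (rule bilinear_map_eqI_on_spanning[OF _ _ span(1,1)])
      fix x y assume "x \<in> p ` B" "y \<in> p ` B"
      then show "br x y = br' x y"
        using br_eq by auto
    qed (use T T' in \<open>auto simp: averaging_lie_algebra_def lie_algebra_def\<close>)
    have P: "P = P'"
    proof (rule linear_eqI_on_spanning[OF _ _ span(1)])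
      fix x assume "x \<in> p ` B"
      then show "P x = P' x"
        using P_eq by auto
    qed (use T T' in \<open>auto simp: averaging_lie_algebra_def\<close>)
    have \<psi>: "\<psi> = \<psi>'"
    proof (rule bilinear_map_eqI_on_spanning[OF _ _ span])
      fix x y assume "x \<in> p ` B" "y \<in> q ` B"
      then show "\<psi> x y = \<psi>' x y"
        using \<psi>_eq by auto
    qed (use T T' in \<open>auto simp: averaging_representation_def lie_representation_def\<close>)
    have Q: "Q = Q'"
    proof (rule linear_eqI_on_spanning[OF _ _ span(2)])
      fix x assume "x \<in> q ` B"
      then show "Q x = Q' x"
        using Q_eq by auto
    qed (use T T' in \<open>auto simp: averaging_representation_def\<close>)
    note r = rep[OF T(3,4)] and r' = rep[OF T'(3,4)]
    have "fst (rep c) = fst (rep c')"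
    proof (rule multilinear_eqI_on_spanning[OF _ _ span(1)])
      fix xs :: "'a list" assume "length xs = 3" "set xs \<subseteq> p ` B"
      then show "fst (rep c) xs = fst (rep c') xs"
        using f_eq by (auto simp: length_Suc_conv numeral_3_eq_3)
    qed (use r r' in \<open>auto simp: alie_cocycles_def alie_cochains_def alternating_def\<close>)
    moreover have "snd (rep c) = snd (rep c')"
    proof (rule multilinear_eqI_on_spanning[OF _ _ span(1)])
      fix xs :: "'a list" assume "length xs = 2" "set xs \<subseteq> p ` B"
      then show "snd (rep c) xs = snd (rep c') xs"
        using \<theta>_eq by (auto simp: length_Suc_conv numeral_2_eq_2)
    qed (use r r' in \<open>auto simp: alie_cocycles_def alie_cochains_def\<close>)
    ultimately have "rep c = rep c'" by (simp add: prod_eq_iff)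
    then show "T = T'"
      using r(2) r'(2) T(1) T'(1) br P \<psi> Q by metis
  qed
  moreover have "code ` alie_triples s u \<subseteq> ({..<6} \<times> B \<times> B \<times> B) \<rightarrow>\<^sub>E UNIV"
    by (auto simp: code_def split: if_splits)
  ultimately show ?thesis unfolding lepoll_def by blast
qed

text \<open>With zero brackets every averaging condition is trivially true, so both operators are free.\<close>

lemma zero_bracket_triple:
  fixes s :: "'k::field_char_0 \<Rightarrow> 'a::ab_group_add \<Rightarrow> 'a" and u :: "'k \<Rightarrow> 'b::ab_group_add \<Rightarrow> 'b"
  assumes vs: "vector_space s" "vector_space u"
    and P: "Vector_Spaces.linear s s P" and Q: "Vector_Spaces.linear u u Q"
  shows "((0, P), (0, Q), alie_cohomologous s u 0 P 0 Q 3 `` {0}) \<in>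
    linf_triple s u ` skeletal_averaging_linf s u"
proof -
  interpret ss: vector_space_pair s s using assms by (simp add: vector_space_pair_def)
  interpret su: vector_space_pair s u using assms by (simp add: vector_space_pair_def)
  interpret uu: vector_space_pair u u using assms by (simp add: vector_space_pair_def)
  have P0: "P 0 = 0" and Q0: "Q 0 = 0"
    using ss.linear_0[OF P] uu.linear_0[OF Q] by auto
  note lin = ss.linear_zero su.linear_zero uu.linear_zero
  have 1: "averaging_lie_algebra s 0 P"
    using P P0 lin by (simp add: averaging_lie_algebra_def lie_algebra_def bilinear_map_def zero_fun_def)
  have 2: "averaging_representation s u 0 P 0 Q"
    unfolding averaging_representation_def lie_representation_def bilinear_map_def zero_fun_apply
    by (intro conjI allI Q lin; simp add: Q0)
  have "mmap3 0 xs = (0 :: 'b)" "mmap2 0 xs = (0 :: 'b)" for xs :: "'a list"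
    by (cases "(0 :: 'a \<Rightarrow> 'a \<Rightarrow> 'a \<Rightarrow> 'b, xs)" rule: mmap3.cases; simp)
      (cases "(0 :: 'a \<Rightarrow> 'a \<Rightarrow> 'b, xs)" rule: mmap2.cases; simp)
  then have zero: "mmap3 0 = (0 :: 'a list \<Rightarrow> 'b)" "mmap2 0 = (0 :: 'a list \<Rightarrow> 'b)"
    by (simp_all add: fun_eq_iff)
  have 3: "(mmap3 0, mmap2 0) \<in> alie_cocycles s u 0 P 0 Q 3"
    unfolding alie_cocycles_3_iff[OF vs(2)] 
    using lin Q0 by (simp add: trilinear_map_def bilinear_map_def skew3_def zero_fun_def)
  from cocycle_eq_linf_cochain[OF vs 1 2 3] obtain A where
    "A \<in> skeletal_bilinear_averaging_linf s u" "avg2 A = 0"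
    "linf_triple s u A = ((0, P), (0, Q), alie_cohomologous s u 0 P 0 Q 3 `` {(mmap3 0, mmap2 0)})"
    by blast
  then show ?thesis
    by (auto simp: skeletal_averaging_linf_eq skew2_def zero zero_prod_def intro!: rev_image_eqI)
qed

text \<open>Linear extension from a basis.\<close>

lemma endomorphisms_from_basis_values:
  fixes s :: "'k::field \<Rightarrow> 'a::ab_group_add \<Rightarrow> 'a"
  assumes "vector_space s" and "\<not> module.dependent s B"
  shows "\<exists>f. (\<forall>g :: 'a \<Rightarrow> 'a. Vector_Spaces.linear s s (f g)) \<and> inj_on f (B \<rightarrow>\<^sub>E (UNIV :: 'a set))"
proof -
  interpret vector_space_pair s s using assms by (simp add: vector_space_pair_def)
  have 1: "Vector_Spaces.linear s s (construct B g)" for g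
    using assms(2) by (rule linear_construct)
  have 2: "inj_on (construct B) (B \<rightarrow>\<^sub>E UNIV)"
  proof (rule inj_onI)
    fix g h assume gh: "g \<in> B \<rightarrow>\<^sub>E UNIV" "h \<in> B \<rightarrow>\<^sub>E UNIV" and "construct B g = construct B h"
    then have "g b = h b" if "b \<in> B" for b
      using construct_basis[OF assms(2) that] by metis
    then show "g = h" by (rule PiE_ext[OF gh])
  qed
  show ?thesis using 1 2 by blast
qed

lemma basis_infinite_or_trivial:
  fixes s :: "'k::field_char_0 \<Rightarrow> 'a::ab_group_add \<Rightarrow> 'a"
  assumes "vector_space s" and "module.span s B = UNIV"
  shows "infinite (UNIV :: 'a set) \<and> B \<noteq> {} \<or> (\<exists>a. (UNIV :: 'a set) = {a})"
proof (cases "B \<subseteq> {0}")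
  interpret vector_space s by fact
  case True
  then have "span B \<subseteq> {0}"
    using span_mono[OF True] by simp
  then show ?thesis
    using assms(2) by auto
next
  interpret vector_space s by fact
  case False
  then obtain v where v: "v \<in> B" "v \<noteq> 0" by auto
  have "inj (\<lambda>c. s c v)"
    using v by (auto intro!: injI)
  then have "infinite (range (\<lambda>c. s c v))"
    using infinite_UNIV_char_0 finite_imageD by blast
  then have "infinite (UNIV :: 'a set)"
    by (rule infinite_super[OF subset_UNIV])
  then show ?thesis
    using v(1) by blast
qed

text \<open>A space of smaller dimension embeds into one of larger dimension, by linear extension of an
  injection between the bases.\<close>

lemma inj_of_inj_on_basis:
  fixes s :: "'k::field \<Rightarrow> 'a::ab_group_add \<Rightarrow> 'a" and u :: "'k \<Rightarrow> 'b::ab_group_add \<Rightarrow> 'b"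
  assumes "vector_space s" "vector_space u" and B: "\<not> module.dependent s B" "module.span s B = UNIV"
    and C: "\<not> module.dependent u C" and f: "inj_on f B" "f ` B \<subseteq> C"
  shows "\<exists>i :: 'a \<Rightarrow> 'b. inj i"
proof -
  interpret vector_space_pair s u using assms by (simp add: vector_space_pair_def)
  have img: "construct B f ` B = f ` B"
    using construct_basis[OF B(1)] by force
  have "inj_on (construct B f) (vs1.span B)"
  proof (rule linear_inj_on_span_independent_image[OF linear_construct[OF B(1)]])
    show "vs2.independent (construct B f ` B)"
      unfolding img using C f(2) by (rule vs2.independent_mono)
    show "inj_on (construct B f) B"
      using f(1) construct_basis[OF B(1)] by (metis inj_on_cong)
  qed
  then show ?thesis using B(2) by auto
qed

text \<open>The cardinality comparison: the triples are counted by endomorphisms of the space of larger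
  dimension, whose basis indexes the other basis as well.\<close>

lemma alie_triples_lepoll_skew:
  fixes s :: "'k::field_char_0 \<Rightarrow> 'a::ab_group_add \<Rightarrow> 'a" and u :: "'k \<Rightarrow> 'b::ab_group_add \<Rightarrow> 'b"
  assumes vs: "vector_space s" "vector_space u"
  shows "alie_triples s u \<lesssim> linf_triple s u ` skeletal_averaging_linf s u" (is "_ \<lesssim> ?T'")
proof -
  interpret s: vector_space s by fact
  interpret u: vector_space u by fact
  obtain B where B: "s.independent B" "s.span B = UNIV"
    using s.independent_extend_basis[OF s.independent_empty] s.span_extend_basis[OF s.independent_empty] ..
  obtain C where C: "u.independent C" "u.span C = UNIV"
    using u.independent_extend_basis[OF u.independent_empty] u.span_extend_basis[OF u.independent_empty] ..
  let ?t = "\<lambda>P Q. ((0, P), (0, Q), alie_cohomologous s u 0 P 0 Q 3 `` {0})"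
  have "B \<lesssim> C \<or> C \<lesssim> B"
    unfolding lepoll_def card_of_ordLeq
    by (rule ordLeq_total[OF card_of_Well_order card_of_Well_order])
  then show ?thesis
  proof
    assume "C \<lesssim> B"
    then obtain f where f: "inj_on f C" "f ` C \<subseteq> B" by (auto simp: lepoll_def)
    obtain j :: "'b \<Rightarrow> 'a" where j: "inj j"
      using inj_of_inj_on_basis[OF vs(2,1) C B(1) f] by blast
    \<comment> \<open>The inverse of \<open>f\<close> lets \<open>B\<close> index the basis \<open>C\<close>; its values outside the range of \<open>f\<close> are harmless
      because only spanning is required.\<close>
    have "C \<subseteq> inv_into C f ` B"
      using f by (force simp: image_iff)
    then have "u.span (inv_into C f ` B) = UNIV"
      using C(2) u.span_mono by blast
    then have "alie_triples s u \<lesssim> ({..<6::nat} \<times> B \<times> B \<times> B) \<rightarrow>\<^sub>E (UNIV :: 'a set)"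
      by (intro alie_triples_lepoll[OF vs, of id B "inv_into C f" id j]) (use B j in auto)
    also have "\<dots> \<lesssim> B \<rightarrow>\<^sub>E (UNIV :: 'a set)"
      by (rule funcset_multi_lepoll[OF basis_infinite_or_trivial[OF vs(1) B(2)]])
    also have "\<dots> \<lesssim> ?T'"
    proof -
      obtain F where F: "\<And>g. Vector_Spaces.linear s s (F g)" "inj_on F (B \<rightarrow>\<^sub>E (UNIV :: 'a set))"
        using endomorphisms_from_basis_values[OF vs(1) B(1)] by blast
      have "inj_on (\<lambda>g. ?t (F g) id) (B \<rightarrow>\<^sub>E UNIV)"
        using F(2) by (auto simp: inj_on_def)
      moreover have "(\<lambda>g. ?t (F g) id) ` (B \<rightarrow>\<^sub>E UNIV) \<subseteq> ?T'"
        using zero_bracket_triple[OF vs F(1) u.linear_id] by (auto simp: id_def)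
      ultimately show ?thesis unfolding lepoll_def by blast
    qed
    finally show ?thesis .
  next
    assume "B \<lesssim> C"
    then obtain f where f: "inj_on f B" "f ` B \<subseteq> C" by (auto simp: lepoll_def)
    obtain i :: "'a \<Rightarrow> 'b" where i: "inj i"
      using inj_of_inj_on_basis[OF vs B C(1) f] by blast
    have "B \<subseteq> inv_into B f ` C"
      using f by (force simp: image_iff)
    then have "s.span (inv_into B f ` C) = UNIV"
      using B(2) s.span_mono by blast
    then have "alie_triples s u \<lesssim> ({..<6::nat} \<times> C \<times> C \<times> C) \<rightarrow>\<^sub>E (UNIV :: 'b set)"
      by (intro alie_triples_lepoll[OF vs, of "inv_into B f" C id i id]) (use C i in auto)
    also have "\<dots> \<lesssim> C \<rightarrow>\<^sub>E (UNIV :: 'b set)"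
      by (rule funcset_multi_lepoll[OF basis_infinite_or_trivial[OF vs(2) C(2)]])
    also have "\<dots> \<lesssim> ?T'"
    proof -
      obtain F where F: "\<And>g. Vector_Spaces.linear u u (F g)" "inj_on F (C \<rightarrow>\<^sub>E (UNIV :: 'b set))"
        using endomorphisms_from_basis_values[OF vs(2) C(1)] by blast
      have "inj_on (\<lambda>g. ?t id (F g)) (C \<rightarrow>\<^sub>E UNIV)"
        using F(2) by (auto simp: inj_on_def)
      moreover have "(\<lambda>g. ?t id (F g)) ` (C \<rightarrow>\<^sub>E UNIV) \<subseteq> ?T'"
        using zero_bracket_triple[OF vs s.linear_id F(1)] by (auto simp: id_def)
      ultimately show ?thesis unfolding lepoll_def by blast
    qed
    finally show ?thesis .
  qed
qed

theorem theorem3p5: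
  fixes s0 :: "'k::field_char_0 \<Rightarrow> 'a::ab_group_add \<Rightarrow> 'a"
    and s1 :: "'k \<Rightarrow> 'b::ab_group_add \<Rightarrow> 'b"
  assumes "vector_space s0" and "vector_space s1"
  shows "(let S = skeletal_averaging_linf s0 s1;
              B = skeletal_bilinear_averaging_linf s0 s1;
              T = alie_triples s0 s1
          in
            (\<exists>\<Phi>. bij_betw \<Phi> (S // skeletal_equiv s0 s1 S) T) \<and>
            (\<exists>\<Phi>. bij_betw \<Phi> (S // skeletal_equiv s0 s1 S)
                   {(g, V, c) \<in> T. \<exists>f \<theta>. (f, mmap2 \<theta>) \<in> c \<and> skew2 \<theta>} \<and>
                 (\<forall>A\<in>S. \<Phi> (skeletal_equiv s0 s1 S `` {A}) = linf_triple s0 s1 A)) \<and>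
            (\<exists>\<Phi>. bij_betw \<Phi> (B // skeletal_equiv s0 s1 B) T \<and>
                 (\<forall>A\<in>B. \<Phi> (skeletal_equiv s0 s1 B `` {A}) = linf_triple s0 s1 A)))"
proof -
  let ?S = "skeletal_averaging_linf s0 s1" and ?B = "skeletal_bilinear_averaging_linf s0 s1"
    and ?T = "alie_triples s0 s1"
  have "?S \<subseteq> ?B" by (auto simp: skeletal_averaging_linf_eq)
  then obtain \<Phi> where \<Phi>: "bij_betw \<Phi> (?S // skeletal_equiv s0 s1 ?S) (linf_triple s0 s1 ` ?S)"
      "\<And>A. A \<in> ?S \<Longrightarrow> \<Phi> (skeletal_equiv s0 s1 ?S `` {A}) = linf_triple s0 s1 A"
    using bij_betw_quotient_kernel[OF skeletal_equiv_eq_kernel[OF assms]] by metis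
  obtain \<Psi> where \<Psi>: "bij_betw \<Psi> (?B // skeletal_equiv s0 s1 ?B) (linf_triple s0 s1 ` ?B)"
      "\<And>A. A \<in> ?B \<Longrightarrow> \<Psi> (skeletal_equiv s0 s1 ?B `` {A}) = linf_triple s0 s1 A"
    using bij_betw_quotient_kernel[OF skeletal_equiv_eq_kernel[OF assms subset_refl]] by metis
  have "?S // skeletal_equiv s0 s1 ?S \<approx> linf_triple s0 s1 ` ?S"
    unfolding eqpoll_def using \<Phi>(1) by (intro exI[of _ \<Phi>])
  also have "\<dots> \<approx> ?T"
  proof (rule lepoll_antisym)
    show "linf_triple s0 s1 ` ?S \<lesssim> ?T"
      unfolding linf_triple_image_skew[OF assms] by (rule subset_imp_lepoll) blast
  qed (rule alie_triples_lepoll_skew[OF assms])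
  finally have card: "\<exists>\<Phi>. bij_betw \<Phi> (?S // skeletal_equiv s0 s1 ?S) ?T"
    unfolding eqpoll_def .
  show ?thesis
    unfolding Let_def linf_triple_image_skew[OF assms, symmetric]
  proof (intro conjI)
    show "\<exists>\<Phi>. bij_betw \<Phi> (?S // skeletal_equiv s0 s1 ?S) (linf_triple s0 s1 ` ?S) \<and>
        (\<forall>A\<in>?S. \<Phi> (skeletal_equiv s0 s1 ?S `` {A}) = linf_triple s0 s1 A)"
      using \<Phi> by blast
    show "\<exists>\<Phi>. bij_betw \<Phi> (?B // skeletal_equiv s0 s1 ?B) ?T \<and>
        (\<forall>A\<in>?B. \<Phi> (skeletal_equiv s0 s1 ?B `` {A}) = linf_triple s0 s1 A)"
      using \<Psi> unfolding linf_triple_image[OF assms] by blast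
  qed (rule card)
qed

end
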